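(* For every pair of integers $r\geq 3$ and $\ell\geq 4$, there exists a constant $C=C(r, \ell)>0$ such that, for every positive integer $n$, $$|\mathrm{Forb}_L(n, r, \ell)|\leq 2^{Cn^{1+1/\lfloor\ell/2\rfloor}}.$$
   Context: An $r$-graph ($r$-uniform hypergraph) consists of a vertex set and a set of edges, each edge being an $r$-element subset of the vertex set. An $r$-graph $H$ is linear if $|e\cap e'|\leq 1$ for all distinct $e,e'\in E(H)$. For $k\geq 3$, the linear cycle $C_k^r$ is an $r$-graph with $k$ edges $e_1,\ldots,e_k$ such that $|e_i\cap e_{i+1}|=1$ for $1\le i\le k-1$, $|e_k\cap e_1|=1$, and $e_i\cap e_j=\emptyset$ for all other pairs $i\ne j$; for $k=3$ the three pairwise intersection vertices are required to be distinct. The girth of a linear $r$-graph $H$ is the smallest integer $k\ge 3$ such that $H$ contains a $C_k^r$ as a subgraph (infinite if there is none). $\mathrm{Forb}_L(n,r,\ell)$ denotes the set of all linear $r$-graphs with vertex set $[n]=\{1,\ldots,n\}$ whose girth is larger than $\ell$. *)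

theory Defs
  imports Complex_Main "HOL-Library.Extended_Nat"
begin

text \<open>A hypergraph is a pair of a vertex set and an edge set.\<close>

type_synonym 'a hypergraph = "'a set \<times> 'a set set"

abbreviation verts :: "'a hypergraph \<Rightarrow> 'a set" where
  "verts H \<equiv> fst H"

abbreviation edges :: "'a hypergraph \<Rightarrow> 'a set set" where
  "edges H \<equiv> snd H"

definition r_graph :: "nat \<Rightarrow> 'a hypergraph \<Rightarrow> bool" where
  "r_graph r H \<longleftrightarrow> (\<forall>e \<in> edges H. e \<subseteq> verts H \<and> finite e \<and> card e = r)"

definition subgraph :: "'a hypergraph \<Rightarrow> 'a hypergraph \<Rightarrow> bool" where
  "subgraph F H \<longleftrightarrow> verts F \<subseteq> verts H \<and> edges F \<subseteq> edges H"

definition linear_hypergraph :: "'a hypergraph \<Rightarrow> bool" where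
  "linear_hypergraph H \<longleftrightarrow>
     (\<forall>e \<in> edges H. \<forall>e' \<in> edges H. e \<noteq> e' \<longrightarrow> card (e \<inter> e') \<le> 1)"

text \<open>\<open>linear_cycle r k F\<close> says that \<open>F\<close> is a copy of the linear cycle with \<open>k\<close> edges of size
  \<open>r\<close>, without isolated vertices. For \<open>k = 3\<close> any two edges are consecutive, and the three
  intersections are singletons, so that their being distinct as sets means that the three
  intersection vertices are distinct.\<close>

definition linear_cycle :: "nat \<Rightarrow> nat \<Rightarrow> 'a hypergraph \<Rightarrow> bool" where
  "linear_cycle r k F \<longleftrightarrow> 3 \<le> k \<and> r_graph r F \<and> verts F = \<Union> (edges F) \<and>
     (\<exists>e :: nat \<Rightarrow> 'a set. inj_on e {1..k} \<and> edges F = e ` {1..k} \<and>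
        (\<forall>i \<in> {1..k - 1}. card (e i \<inter> e (i + 1)) = 1) \<and>
        card (e k \<inter> e 1) = 1 \<and>
        (\<forall>i j. 1 \<le> i \<and> i < j \<and> j \<le> k \<and> j \<noteq> i + 1 \<and> \<not> (i = 1 \<and> j = k)
           \<longrightarrow> e i \<inter> e j = {}) \<and>
        (k = 3 \<longrightarrow> distinct [e 1 \<inter> e 2, e 2 \<inter> e 3, e 3 \<inter> e 1]))"

text \<open>The infimum of a nonempty set of \<open>enat\<close> values is its minimum, and that of the empty set
  is \<open>\<infinity>\<close>.\<close>

definition girth :: "nat \<Rightarrow> 'a hypergraph \<Rightarrow> enat" where
  "girth r H = Inf {enat k | k. 3 \<le> k \<and> (\<exists>F. subgraph F H \<and> linear_cycle r k F)}"

definition Forb_L :: "nat \<Rightarrow> nat \<Rightarrow> nat \<Rightarrow> nat hypergraph set" where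
  "Forb_L n r l =
     {H. verts H = {1..n} \<and> r_graph r H \<and> linear_hypergraph H \<and> enat l < girth r H}"

text \<open>Finiteness ensures that \<open>card (Forb_L n r l)\<close> is the actual number of hypergraphs.\<close>

lemma finite_Forb_L: "finite (Forb_L n r l)"
proof (rule finite_subset)
  show "Forb_L n r l \<subseteq> {{1..n}} \<times> Pow (Pow {1..n})"
  proof
    fix H assume "H \<in> Forb_L n r l"
    then have V: "verts H = {1..n}" and R: "r_graph r H"
      by (simp_all add: Forb_L_def)
    from R have "edges H \<subseteq> Pow (verts H)"
      by (auto simp: r_graph_def)
    with V have "verts H \<in> {{1..n}}" and "edges H \<in> Pow (Pow {1..n})"
      by simp_all
    then show "H \<in> {{1..n}} \<times> Pow (Pow {1..n})"
      by (simp only: mem_Times_iff)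
  qed
qed simp

end

theory Submission
  imports Defs "HOL-Analysis.Convex" "HOL-Library.FuncSet"
begin

text \<open>
  Let \<open>p + 1\<close> be half of the forbidden length, rounded down. A linear hypergraph of girth larger
  than \<open>2 * p + 2\<close> can be recovered from its shadow, the graph that joins two vertices whenever
  an edge contains both, because a triangle of the shadow must lie inside one edge. So it
  suffices to count shadows. What survives of the girth condition is that every cycle of length at
  most \<open>2 * p + 2\<close> of the shadow lies in a clique (\<open>cycles_in_cliques\<close>). Working with the shadow
  and not with a sparser graph saves the logarithm that a naive encoding loses: when a vertex is
  added, the grouping of its neighbours into edges is already visible among the older vertices.

  The shadows are counted by the method of Kleitman and Winston. Remove vertices of minimum degree
  one by one and rebuild the graph in the opposite order. When \<open>v\<close> is added to \<open>E\<close>, its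
  neighbourhood consists of boundedly large cliques. Split it into a bounded number of sets, each
  with at most one vertex from each clique. No two members of such a set are joined by a walk of
  length \<open>2 * p\<close> in \<open>E\<close>, because this would create a short cycle through \<open>v\<close> that lies in no clique.
  The number of sets with this property that are not larger than the degree of \<open>v\<close> is
  \<open>exp (O(n powr (1 / (p + 1))))\<close>, and multiplying over the \<open>n\<close> vertices gives the theorem.

  For this bound, select a star in each clique. The resulting graph, \<open>thin E\<close>, has no cycle of
  length at most \<open>2 * p + 2\<close>, and its degrees are smaller than those of \<open>E\<close> only by a constant
  factor. If the degrees exceed \<open>D\<close>, then from each vertex one can grow \<open>D ^ p\<close> paths of length
  \<open>p\<close> with distinct ends, while two vertices share only \<open>O(D ^ (p - 1))\<close> ends. Double counting of
  common ends shows that every vertex set of size at least \<open>2 * n / D ^ p\<close> contains a vertex joined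
  by walks of length \<open>2 * p\<close> to a proportion of order \<open>D ^ (p + 1) / n\<close> of the set
  (\<open>many_close_pairs\<close>). By \<open>card_independent_sets_le\<close>, a set of pairwise unjoined vertices is
  therefore described by a short sequence of branching vertices and a subset of a set of size at most
  \<open>2 * n / D ^ p\<close>. With \<open>D\<close> of the order of the degree of \<open>v\<close>, capped at \<open>n powr (1 / (p + 1))\<close>,
  there are few enough subsets of the required size, and the branching vertices cost only powers of
  \<open>ln n\<close> unless \<open>D\<close> is so small that it suffices to count all sets of size \<open>O(D)\<close>.
\<close>

section \<open>Breadth-first levels in graphs without short cycles\<close>

definition delete_vertex :: "'a \<Rightarrow> 'a rel \<Rightarrow> 'a rel" where
  "delete_vertex w E = {(x, y) \<in> E. x \<noteq> w \<and> y \<noteq> w}"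

text \<open>
  For a symmetric irreflexive \<open>E\<close>, this says that there is no cycle of length at most
  \<open>2 * p + 2\<close>. It is phrased with walks that avoid one vertex of the cycle, so that no
  simple path ever has to be extracted from a walk.
\<close>

definition no_short_cycle :: "nat \<Rightarrow> 'a rel \<Rightarrow> bool" where
  "no_short_cycle p E \<longleftrightarrow> sym E \<and> irrefl E \<and>
     (\<forall>w z z' m. (w, z) \<in> E \<longrightarrow> (w, z') \<in> E \<longrightarrow> z \<noteq> z' \<longrightarrow> m \<le> 2 * p \<longrightarrow>
        (z, z') \<notin> delete_vertex w E ^^ m)"

lemma delete_vertex_subset: "delete_vertex w E \<subseteq> E"
  by (auto simp: delete_vertex_def)

lemma sym_delete_vertex: "sym E \<Longrightarrow> sym (delete_vertex w E)"
  by (auto simp: delete_vertex_def sym_def)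

lemma relpow_subset:
  fixes R S :: "'a rel"
  assumes "R \<subseteq> S"
  shows "R ^^ m \<subseteq> S ^^ m"
  using assms by (induction m) (simp_all add: relcomp_mono)

lemma sym_relpow:
  assumes "sym R" "(x, y) \<in> R ^^ m"
  shows "(y, x) \<in> R ^^ m"
  using assms(2)
proof (induction m arbitrary: y)
  case (Suc m)
  then obtain u where "(x, u) \<in> R ^^ m" "(u, y) \<in> R"
    by auto
  with Suc.IH assms(1) show ?case
    by (meson relpow_Suc_I2 symD)
qed auto

lemma relpow_trans: "(x, y) \<in> R ^^ a \<Longrightarrow> (y, z) \<in> R ^^ b \<Longrightarrow> (x, z) \<in> R ^^ (a + b)"
  by (auto simp: relpow_add)

lemma walk_avoids_vertex:
  assumes "(y, z) \<in> E ^^ a" "z \<noteq> w" "\<forall>i<a. (y, w) \<notin> E ^^ i"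
  shows "(y, z) \<in> delete_vertex w E ^^ a"
  using assms
proof (induction a arbitrary: z)
  case (Suc a)
  from Suc.prems obtain u where u: "(y, u) \<in> E ^^ a" "(u, z) \<in> E"
    by auto
  from u Suc.prems have "u \<noteq> w" by blast
  with u Suc show ?case
    by (auto simp: delete_vertex_def)
qed auto

text \<open>
  Walks from \<open>y\<close> to two neighbours of \<open>w\<close> that are too short to pass through \<open>w\<close> combine to a walk
  between the two neighbours that avoids \<open>w\<close>, and hence to a short cycle through \<open>w\<close>.
\<close>

lemma unique_neighbour_towards:
  assumes "no_short_cycle p E" "(w, z) \<in> E" "(w, z') \<in> E"
    and "(y, z) \<in> E ^^ a" "(y, z') \<in> E ^^ b"
    and "\<And>i. i < a \<or> i < b \<Longrightarrow> (y, w) \<notin> E ^^ i" and "a + b \<le> 2 * p"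
  shows "z = z'"
proof (rule ccontr)
  assume "z \<noteq> z'"
  have "z \<noteq> w" "z' \<noteq> w" and "sym E"
    using assms(1-3) by (auto simp: no_short_cycle_def irrefl_def)
  then have "(y, z) \<in> delete_vertex w E ^^ a" "(y, z') \<in> delete_vertex w E ^^ b"
    using assms by (auto intro!: walk_avoids_vertex)
  then have "(z, z') \<in> delete_vertex w E ^^ (a + b)"
    using \<open>sym E\<close> by (blast intro: relpow_trans sym_relpow sym_delete_vertex)
  with assms \<open>z \<noteq> z'\<close> show False
    by (auto simp: no_short_cycle_def)
qed

text \<open>
  These are the levels of a breadth-first search from \<open>x\<close> that follows only the arcs from \<open>w\<close> to
  \<open>N w\<close>, but measures distance in all of \<open>E\<close>. Restricting the arcs keeps the number of
  children bounded when the degrees of \<open>E\<close> are not.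
\<close>

fun level :: "('a \<Rightarrow> 'a set) \<Rightarrow> 'a rel \<Rightarrow> nat \<Rightarrow> 'a \<Rightarrow> 'a set" where
  "level N E 0 x = {x}"
| "level N E (Suc j) x = {u. (\<exists>w \<in> level N E j x. u \<in> N w) \<and> (\<forall>i\<le>j. (x, u) \<notin> E ^^ i)}"

locale branching =
  fixes p D :: nat and A :: "'a set" and E :: "'a rel" and N :: "'a \<Rightarrow> 'a set"
  assumes girth: "no_short_cycle p E"
    and finite_A: "finite A" and E_A: "E \<subseteq> A \<times> A"
    and N_E: "w \<in> A \<Longrightarrow> N w \<subseteq> E `` {w}"
    and card_N: "w \<in> A \<Longrightarrow> card (N w) = Suc D"
begin

abbreviation "L \<equiv> level N E"

lemma level_A: "x \<in> A \<Longrightarrow> L j x \<subseteq> A"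
proof (induction j)
  case (Suc j)
  then show ?case using N_E E_A by fastforce
qed auto

lemma finite_level: "x \<in> A \<Longrightarrow> finite (L j x)"
  using level_A finite_A finite_subset by metis

lemma finite_N: "w \<in> A \<Longrightarrow> finite (N w)"
  using card_N card.infinite by fastforce

lemma N_adjacent: "w \<in> A \<Longrightarrow> u \<in> N w \<Longrightarrow> (w, u) \<in> E \<and> (u, w) \<in> E"
  using N_E girth by (auto simp: no_short_cycle_def dest: symD)

lemma level_walk: "x \<in> A \<Longrightarrow> u \<in> L j x \<Longrightarrow> (x, u) \<in> E ^^ j"
proof (induction j arbitrary: u)
  case (Suc j)
  then obtain w where w: "w \<in> L j x" "u \<in> N w" by auto
  with Suc.prems level_A have "w \<in> A" by blast
  with w N_E have "(w, u) \<in> E" by blast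
  with Suc w show ?case by auto
qed auto

lemma level_distance: "u \<in> L j x \<Longrightarrow> i < j \<Longrightarrow> (x, u) \<notin> E ^^ i"
  by (cases j) auto

text \<open>
  At most one of the \<open>Suc D\<close> selected neighbours of a vertex leads back towards \<open>x\<close>, and a vertex
  of the next level has only one parent. Both are instances of \<open>unique_neighbour_towards\<close>.
\<close>

lemma card_level_ge:
  assumes "x \<in> A"
  shows "j \<le> p \<Longrightarrow> D ^ j \<le> card (L j x)"
proof (induction j)
  case (Suc j)
  define ch where "ch w = {u \<in> N w. \<forall>i\<le>j. (x, u) \<notin> E ^^ i}" for w
  have L: "L (Suc j) x = (\<Union>w \<in> L j x. ch w)"
    by (auto simp: ch_def)
  have A: "w \<in> A" if "w \<in> L j x" for w
    using level_A that assms by blast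
  have fin: "finite (ch w)" if "w \<in> L j x" for w
    using A[OF that] finite_N by (auto simp: ch_def)
  have ge: "D \<le> card (ch w)" if w: "w \<in> L j x" for w
  proof -
    have "card (N w - ch w) \<le> 1"
    proof -
      have "z = z'" if zz: "z \<in> N w - ch w" "z' \<in> N w - ch w" for z z'
      proof -
        from zz obtain a b where ab: "a \<le> j" "(x, z) \<in> E ^^ a" "b \<le> j" "(x, z') \<in> E ^^ b"
          by (auto simp: ch_def)
        have "(w, z) \<in> E" "(w, z') \<in> E" using zz N_E A[OF w] by auto
        moreover have "(x, w) \<notin> E ^^ i" if "i < a \<or> i < b" for i
          using level_distance[OF w, of i] that ab by linarith
        ultimately show ?thesis
          using ab Suc.prems by (intro unique_neighbour_towards[OF girth, of w z z' x a b]) auto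
      qed
      then show ?thesis
        using card_le_Suc0_iff_eq[of "N w - ch w"] finite_N[OF A[OF w]] by auto
    qed
    moreover have "card (N w) = card (ch w) + card (N w - ch w)"
      using finite_N[OF A[OF w]] card_Diff_subset[of "ch w" "N w"] fin[OF w]
        card_mono[of "N w" "ch w"]
      by (auto simp: ch_def)
    ultimately show ?thesis using card_N[OF A[OF w]] by linarith
  qed
  have disj: "ch w \<inter> ch w' = {}" if w: "w \<in> L j x" "w' \<in> L j x" "w \<noteq> w'" for w w'
  proof (rule ccontr)
    assume "ch w \<inter> ch w' \<noteq> {}"
    then obtain u where u: "u \<in> ch w" "u \<in> ch w'" by blast
    have "(u, w) \<in> E" "(u, w') \<in> E"
      using u N_adjacent A w by (auto simp: ch_def)
    moreover have "(x, w) \<in> E ^^ j" "(x, w') \<in> E ^^ j"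
      using level_walk assms w by auto
    ultimately have "w = w'"
      using u Suc.prems
      by (intro unique_neighbour_towards[OF girth, of u w w' x j j]) (auto simp: ch_def)
    with w show False by simp
  qed
  have "D ^ Suc j \<le> card (L j x) * D"
    using Suc by simp
  also have "\<dots> \<le> (\<Sum>w\<in>L j x. card (ch w))"
    using sum_bounded_below[of "L j x" D "\<lambda>w. card (ch w)"] ge by simp
  also have "\<dots> = card (L (Suc j) x)"
    unfolding L using fin disj finite_level[OF assms]
    by (subst card_UN_disjoint) auto
  finally show ?case .
qed auto

lemma card_level_le:
  assumes "x \<in> A"
  shows "card (L j x) \<le> Suc D ^ j"
proof (induction j)
  case (Suc j)
  have "L (Suc j) x \<subseteq> (\<Union>w \<in> L j x. N w)" by auto
  then have "card (L (Suc j) x) \<le> card (\<Union>w \<in> L j x. N w)"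
    using finite_level finite_N level_A assms by (intro card_mono) blast+
  also have "\<dots> \<le> (\<Sum>w\<in>L j x. card (N w))"
    using card_UN_le finite_level assms by blast
  also have "\<dots> = card (L j x) * Suc D"
    using card_N level_A[OF assms] by (simp add: subset_iff)
  also have "\<dots> \<le> Suc D ^ Suc j"
    using mult_le_mono1[OF Suc] by (simp only: power_Suc mult.commute)
  finally show ?case .
qed auto

text \<open>
  A common vertex \<open>z\<close> at level \<open>Suc j\<close> has a parent \<open>w\<close> at level \<open>j\<close> of \<open>x\<close>. If \<open>w\<close> has distance at
  most \<open>j\<close> from \<open>y\<close>, it is the only such neighbour of \<open>z\<close> and hence also at level \<open>j\<close> of \<open>y\<close>; each of
  the few such \<open>w\<close> allows \<open>Suc D\<close> choices of \<open>z\<close>. Otherwise \<open>unique_neighbour_towards\<close> leaves at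
  most one \<open>z\<close> for \<open>w\<close>. The resulting bound is smaller than the size of a level by a factor of
  order \<open>D\<close>.
\<close>

lemma card_level_Int_le:
  assumes "x \<in> A" "y \<in> A" "x \<noteq> y"
  shows "j \<le> p \<Longrightarrow> card (L j x \<inter> L j y) \<le> j * Suc D ^ (j - 1)"
proof (induction j)
  case 0
  then show ?case using assms by auto
next
  case (Suc j)
  define M where "M = L j x \<inter> L j y"
  define R where "R w = N w \<inter> L (Suc j) y" for w
  have A: "w \<in> A" if "w \<in> L j x" for w
    using level_A that assms by blast
  have sub: "L (Suc j) x \<inter> L (Suc j) y \<subseteq> (\<Union>w \<in> M. N w) \<union> (\<Union>w \<in> L j x - M. R w)"
    by (auto simp: R_def simp del: level.simps(2)) (auto simp: M_def)
  have R1: "card (R w) \<le> 1" if w: "w \<in> L j x - M" for w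
  proof -
    have "z = z'" if z: "z \<in> R w" "z' \<in> R w" for z z'
    proof -
      have wE: "(w, z) \<in> E" "(w, z') \<in> E" using z N_E A w by (auto simp: R_def)
      show ?thesis
      proof (cases "\<exists>i\<le>j. (y, w) \<in> E ^^ i")
        case False
        moreover have "(y, z) \<in> E ^^ Suc j" "(y, z') \<in> E ^^ Suc j"
          using z level_walk[OF assms(2)] by (auto simp: R_def simp del: level.simps relpow.simps)
        ultimately show ?thesis
          using Suc.prems
          by (intro unique_neighbour_towards[OF girth wE, of y "Suc j" "Suc j"])
            (auto simp del: relpow.simps)
      next
        case True
        then obtain i where i: "i \<le> j" "(y, w) \<in> E ^^ i" by blast
        from z(1) obtain q where q: "q \<in> L j y" "z \<in> N q" and
          far: "\<And>i. i \<le> j \<Longrightarrow> (y, z) \<notin> E ^^ i"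
          by (auto simp: R_def)
        have "q \<in> A" using q level_A assms by blast
        then have "(z, w) \<in> E" "(z, q) \<in> E"
          using N_adjacent A w z q by (auto simp: R_def)
        then have "w = q"
          using far i Suc.prems level_walk[OF assms(2) q(1)]
          by (intro unique_neighbour_towards[OF girth, of z w q y i j]) auto
        with q w show ?thesis by (auto simp: M_def)
      qed
    qed
    then show ?thesis
      using card_le_Suc0_iff_eq[of "R w"] finite_N A w by (auto simp: R_def)
  qed
  have fin: "finite (L j x)" "finite M"
    using finite_level assms by (auto simp: M_def)
  have "card (L (Suc j) x \<inter> L (Suc j) y) \<le> card ((\<Union>w \<in> M. N w) \<union> (\<Union>w \<in> L j x - M. R w))"
    using sub fin finite_N A by (intro card_mono) (auto simp: M_def R_def)
  also have "\<dots> \<le> card (\<Union>w \<in> M. N w) + card (\<Union>w \<in> L j x - M. R w)"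
    by (rule card_Un_le)
  also have "\<dots> \<le> (\<Sum>w\<in>M. card (N w)) + (\<Sum>w\<in>L j x - M. card (R w))"
    using fin by (intro add_mono card_UN_le) auto
  also have "(\<Sum>w\<in>M. card (N w)) = card M * Suc D"
    using card_N A by (simp add: M_def)
  also have "(\<Sum>w\<in>L j x - M. card (R w)) \<le> card (L j x - M)"
    using sum_bounded_above[of "L j x - M" "\<lambda>w. card (R w)" 1] R1 by simp
  also have "\<dots> \<le> card (L j x)"
    using fin by (intro card_mono) auto
  also have "\<dots> \<le> Suc D ^ j"
    by (rule card_level_le[OF assms(1)])
  also have "card M * Suc D \<le> j * Suc D ^ j"
  proof (cases j)
    case 0
    then show ?thesis using assms by (auto simp: M_def)
  next
    case j: (Suc i)
    then have "card M \<le> j * Suc D ^ i"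
      using Suc.IH Suc.prems by (simp add: M_def)
    then have "card M * Suc D \<le> j * Suc D ^ i * Suc D"
      by (rule mult_le_mono1)
    then show ?thesis
      by (simp only: j power_Suc mult_ac)
  qed
  finally show ?case by simp
qed

end

section \<open>Supersaturation of close pairs\<close>

text \<open>
  By Cauchy-Schwarz, the at least \<open>card S * D ^ p\<close> incidences between \<open>S\<close> and the ends of paths
  produce many pairs in \<open>S\<close> with a common end; the assumption on \<open>card S\<close> makes the diagonal pairs
  negligible. Each pair is counted only \<open>O(D ^ (p - 1))\<close> times by \<open>card_level_Int_le\<close>.
\<close>

lemma many_close_pairs:
  fixes E :: "'a rel"
  assumes girth: "no_short_cycle p E" and A: "finite A" "E \<subseteq> A \<times> A" "card A \<le> n"
    and D: "0 < D" "\<And>w. w \<in> A \<Longrightarrow> D < card (E `` {w})" and "0 < n" "0 < p"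
    and S: "S \<subseteq> A" "2 * real n \<le> card S * real D ^ p"
  shows "\<exists>x\<in>S. real D ^ (p + 1) / (real p * 2 ^ (p + 1) * real n) * card S
           \<le> card {y \<in> S. x \<noteq> y \<and> (x, y) \<in> E ^^ (2 * p)}"
proof (rule ccontr)
  assume neg: "\<not> ?thesis"
  have "\<exists>N. \<forall>w\<in>A. N w \<subseteq> E `` {w} \<and> card (N w) = Suc D"
    by (intro bchoice ballI) (metis D(2) Suc_leI obtain_subset_with_card_n)
  then obtain N where N: "\<And>w. w \<in> A \<Longrightarrow> N w \<subseteq> E `` {w}" "\<And>w. w \<in> A \<Longrightarrow> card (N w) = Suc D"
    by blast
  interpret branching p D A E N
    using girth A N by unfold_locales auto
  have finS: "finite S" using S A finite_subset by blast
  have SA: "x \<in> A" if "x \<in> S" for x using that S by blast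
  define s \<beta> M where "s = real (card S)" and "\<beta> = real D ^ (p + 1) / (real p * 2 ^ (p + 1) * real n)"
    and "M = real p * (2 * real D) ^ (p - 1)"
  define f where "f x z = (if z \<in> L p x then 1 else 0 :: real)" for x z
  define close where "close x = {y \<in> S. x \<noteq> y \<and> (x, y) \<in> E ^^ (2 * p)}" for x
  define T where "T = (\<Sum>z\<in>A. \<Sum>x\<in>S. f x z)"
  have sum_f: "(\<Sum>z\<in>A. f x z * f y z) = card (L p x \<inter> L p y)" if "x \<in> S" for x y
  proof -
    have "f x z * f y z = (if z \<in> L p x \<inter> L p y then 1 else 0)" for z
      by (simp add: f_def)
    then have "(\<Sum>z\<in>A. f x z * f y z) = card {z \<in> A. z \<in> L p x \<inter> L p y}"
      using A(1) by (simp flip: sum.inter_filter)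
    also have "{z \<in> A. z \<in> L p x \<inter> L p y} = L p x \<inter> L p y"
      using level_A[of x p] SA[OF that] by auto
    finally show ?thesis .
  qed
  have T: "T = (\<Sum>x\<in>S. card (L p x))"
  proof -
    have "T = (\<Sum>x\<in>S. \<Sum>z\<in>A. f x z * f x z)"
      unfolding T_def by (subst sum.swap) (auto simp: f_def intro!: sum.cong)
    then show ?thesis using sum_f by simp
  qed
  have lower: "s * real D ^ p \<le> T"
  proof -
    have "real D ^ p \<le> card (L p x)" if "x \<in> S" for x
      using card_level_ge[OF SA[OF that] order_refl] by (simp flip: of_nat_power)
    then show ?thesis
      using sum_bounded_below[of S "real D ^ p" "\<lambda>x. real (card (L p x))"] by (simp add: T s_def)
  qed
  have inter: "real (card (L p x \<inter> L p y)) \<le> M" if "x \<in> S" "y \<in> S" "x \<noteq> y" for x y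
  proof -
    have "real (card (L p x \<inter> L p y)) \<le> real (p * Suc D ^ (p - 1))"
      unfolding of_nat_le_iff using that SA by (intro card_level_Int_le) auto
    also have "\<dots> \<le> M"
      using D(1) power_mono[of "1 + real D" "2 * real D" "p - 1"]
      unfolding M_def of_nat_mult of_nat_power by (intro mult_left_mono) auto
    finally show ?thesis .
  qed
  have row: "(\<Sum>y\<in>S. real (card (L p x \<inter> L p y))) \<le> card (L p x) + \<beta> * s * M" if x: "x \<in> S" for x
  proof -
    have empty: "L p x \<inter> L p y = {}" if "y \<in> S - {x} - close x" for y
    proof (rule ccontr)
      assume "L p x \<inter> L p y \<noteq> {}"
      then obtain z where "z \<in> L p x" "z \<in> L p y" by blast
      then have "(x, z) \<in> E ^^ p" "(z, y) \<in> E ^^ p"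
        using level_walk SA x that girth by (auto simp: no_short_cycle_def intro: sym_relpow)
      then have "(x, y) \<in> E ^^ (2 * p)"
        by (metis relpow_trans mult_2)
      with that show False by (auto simp: close_def)
    qed
    have "(\<Sum>y\<in>S. real (card (L p x \<inter> L p y)))
        = card (L p x) + (\<Sum>y\<in>S - {x}. real (card (L p x \<inter> L p y)))"
      using finS x by (subst sum.remove[of _ x]) auto
    also have "(\<Sum>y\<in>S - {x}. real (card (L p x \<inter> L p y)))
        = (\<Sum>y\<in>close x. real (card (L p x \<inter> L p y)))"
      using finS empty by (intro sum.mono_neutral_right) (auto simp: close_def)
    also have "\<dots> \<le> card (close x) * M"
      using inter x sum_bounded_above[of "close x" "\<lambda>y. real (card (L p x \<inter> L p y))" M]
      by (auto simp: close_def)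
    also have "\<dots> \<le> \<beta> * s * M"
      using neg x by (intro mult_right_mono)
        (auto simp: close_def \<beta>_def s_def M_def not_le intro: less_imp_le)
    finally show ?thesis by simp
  qed
  have "(\<Sum>z\<in>A. (\<Sum>x\<in>S. f x z)\<^sup>2) = (\<Sum>x\<in>S. \<Sum>y\<in>S. \<Sum>z\<in>A. f x z * f y z)"
    unfolding power2_eq_square sum_product
    by (subst sum.swap, rule sum.cong[OF refl], subst sum.swap, rule refl)
  also have "\<dots> = (\<Sum>x\<in>S. \<Sum>y\<in>S. real (card (L p x \<inter> L p y)))"
    using sum_f by (auto intro!: sum.cong)
  also have "\<dots> \<le> (\<Sum>x\<in>S. card (L p x) + \<beta> * s * M)"
    using row by (intro sum_mono) auto
  also have "\<dots> = T + s * (\<beta> * s * M)"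
    by (simp add: T sum.distrib s_def)
  finally have squares: "(\<Sum>z\<in>A. (\<Sum>x\<in>S. f x z)\<^sup>2) \<le> T + s * (\<beta> * s * M)" .
  have "T\<^sup>2 \<le> (\<Sum>z\<in>A. (\<Sum>x\<in>S. f x z)\<^sup>2) * card A"
    unfolding T_def by (rule sum_squared_le_sum_of_squares)
  also have "\<dots> \<le> (T + s * (\<beta> * s * M)) * n"
  proof (rule mult_mono[OF squares])
    show "0 \<le> T + s * (\<beta> * s * M)"
      by (intro add_nonneg_nonneg mult_nonneg_nonneg) (auto simp: T s_def \<beta>_def M_def sum_nonneg)
  qed (use A(3) in auto)
  finally have upper: "T\<^sup>2 \<le> T * n + s\<^sup>2 * (n * \<beta> * M)"
    by (simp add: algebra_simps power2_eq_square)
  \<comment> \<open>The off-diagonal pairs contribute at most a quarter of \<open>T\<^sup>2\<close>, the diagonal ones at most half.\<close>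
  have prod: "n * \<beta> * M = (real D ^ p)\<^sup>2 / 4"
  proof -
    obtain i where i: "p = Suc i" using \<open>0 < p\<close> by (cases p) auto
    define P where "P = real p"
    have "0 < P" using \<open>0 < p\<close> by (simp add: P_def)
    then show ?thesis using \<open>0 < n\<close> unfolding \<beta>_def M_def P_def[symmetric] unfolding i
      by (simp add: field_simps power_mult_distrib power2_eq_square)
  qed
  define Q where "Q = s * real D ^ p"
  have Q: "2 * n \<le> Q" "Q \<le> T" using S lower by (simp_all add: Q_def s_def)
  have "T\<^sup>2 \<le> T * n + Q\<^sup>2 / 4" using upper prod by (simp add: Q_def power_mult_distrib)
  moreover have "T * n \<le> T * (T / 2)" using Q by (intro mult_left_mono) auto
  moreover have "Q\<^sup>2 \<le> T\<^sup>2" "0 < Q\<^sup>2" using Q \<open>0 < n\<close> by (auto intro!: power_mono)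
  ultimately show False by (simp add: power2_eq_square)
qed

section \<open>Counting small independent sets\<close>

text \<open>
  This is the counting argument of Kleitman and Winston. As long as the current set \<open>T\<close> is large,
  branch on whether a vertex \<open>x\<close> of large degree belongs to the independent set. If it
  does, its neighbours are excluded and the set shrinks by a factor \<open>1 - \<beta>\<close>, so this happens at most
  \<open>q\<close> times. The base \<open>card S + 1\<close> absorbs both branches of the recursion.
\<close>

lemma card_independent_sets_le:
  fixes \<Gamma> :: "'a rel" and \<beta> s0 B :: real
  assumes "finite S" and \<beta>: "0 \<le> \<beta>" "\<beta> \<le> 1"
    and dense: "\<And>T. T \<subseteq> S \<Longrightarrow> s0 < card T \<Longrightarrow> \<exists>x\<in>T. \<beta> * card T \<le> card {y \<in> T. (x, y) \<in> \<Gamma>}"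
    and small: "\<And>T. T \<subseteq> S \<Longrightarrow> card T \<le> s0 \<Longrightarrow> card {I. I \<subseteq> T \<and> card I \<le> d} \<le> B"
    and "card S * (1 - \<beta>) ^ q \<le> s0"
  shows "card {I. I \<subseteq> S \<and> (\<forall>x\<in>I. \<forall>y\<in>I. (x, y) \<notin> \<Gamma>) \<and> card I \<le> d} \<le> real (card S + 1) ^ q * B"
proof -
  define ind where "ind T = {I. I \<subseteq> T \<and> (\<forall>x\<in>I. \<forall>y\<in>I. (x, y) \<notin> \<Gamma>) \<and> card I \<le> d}" for T
  have fin: "finite T" if "T \<subseteq> S" for T using that \<open>finite S\<close> finite_subset by blast
  have fin_ind: "finite (ind T)" if "T \<subseteq> S" for T
    using fin[OF that] by (auto simp: ind_def intro: finite_subset[of _ "Pow T"])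
  have "0 \<le> real (card S) * (1 - \<beta>) ^ q" using \<beta> by simp
  with assms(6) have "0 \<le> s0" by linarith
  with small[of "{}"] have B0: "0 \<le> B" by (simp add: order_trans[OF of_nat_0_le_iff])
  have "card (ind T) \<le> real (card T + 1) ^ q * B"
    if "T \<subseteq> S" "card T * (1 - \<beta>) ^ q \<le> s0" for T q
    using that
  proof (induction "card T" arbitrary: T q rule: less_induct)
    case less
    show ?case
    proof (cases "card T \<le> s0")
      case True
      have "real (card (ind T)) \<le> card {I. I \<subseteq> T \<and> card I \<le> d}"
        unfolding of_nat_le_iff using fin[OF less.prems(1)]
        by (intro card_mono) (auto simp: ind_def)
      also have "\<dots> \<le> B" by (rule small[OF less.prems(1) True])
      finally have B: "real (card (ind T)) \<le> B" .
      also have "B \<le> real (card T + 1) ^ q * B"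
        using mult_right_mono[of 1 "real (card T + 1) ^ q" B] B by (simp add: order_trans[OF of_nat_0_le_iff])
      finally show ?thesis .
    next
      case False
      with less.prems(2) obtain q' where q: "q = Suc q'" by (cases q) auto
      obtain x where x: "x \<in> T" "\<beta> * card T \<le> card {y \<in> T. (x, y) \<in> \<Gamma>}"
        using dense[OF less.prems(1)] False by auto
      define U where "U = {y \<in> T - {x}. (x, y) \<notin> \<Gamma>}"
      have finT: "finite T" and subs: "T - {x} \<subseteq> S" "U \<subseteq> S"
        using less.prems fin by (auto simp: U_def)
      have cx: "card (T - {x}) < card T" "card (T - {x}) + 1 = card T"
        using x card_Suc_Diff1[OF finT x(1)] by linarith+
      have cU: "card U \<le> card (T - {x})" using finT by (auto simp: U_def intro: card_mono)
      have "ind T \<subseteq> ind (T - {x}) \<union> insert x ` ind U"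
      proof
        fix I assume I: "I \<in> ind T"
        show "I \<in> ind (T - {x}) \<union> insert x ` ind U"
        proof (cases "x \<in> I")
          case True
          have "card (I - {x}) \<le> card I" by (rule card_Diff1_le)
          then have "I - {x} \<in> ind U" using I True by (auto simp: ind_def U_def)
          moreover have "I = insert x (I - {x})" using True by blast
          ultimately show ?thesis by blast
        qed (use I in \<open>auto simp: ind_def\<close>)
      qed
      then have "card (ind T) \<le> card (ind (T - {x}) \<union> insert x ` ind U)"
        using fin_ind subs by (intro card_mono) auto
      also have "\<dots> \<le> card (ind (T - {x})) + card (insert x ` ind U)"
        by (rule card_Un_le)
      also have "card (insert x ` ind U) \<le> card (ind U)"
        using fin_ind subs by (intro card_image_le) auto
      finally have "real (card (ind T)) \<le> real (card (ind (T - {x}))) + real (card (ind U))"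
        by linarith
      moreover have "real (card (ind (T - {x}))) \<le> real (card T) ^ q * B"
      proof -
        have "real (card (T - {x})) * (1 - \<beta>) ^ q \<le> real (card T) * (1 - \<beta>) ^ q"
          using cx \<beta> by (intro mult_right_mono) auto
        with less.prems(2) have "real (card (ind (T - {x}))) \<le> real (card (T - {x}) + 1) ^ q * B"
          by (intro less.hyps[OF cx(1) subs(1)]) linarith
        then show ?thesis unfolding cx(2) .
      qed
      moreover have "real (card (ind U)) \<le> real (card T) ^ q' * B"
      proof -
        have "card U + card {y \<in> T. (x, y) \<in> \<Gamma>} \<le> card T"
          using finT by (subst card_Un_disjoint[symmetric]) (auto simp: U_def intro!: card_mono)
        then have "real (card U) \<le> real (card T) - \<beta> * card T"
          using x(2) by linarith
        then have "real (card U) * (1 - \<beta>) ^ q' \<le> (real (card T) - \<beta> * card T) * (1 - \<beta>) ^ q'"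
          using \<beta> by (intro mult_right_mono) auto
        also have "\<dots> = card T * (1 - \<beta>) ^ q" by (simp add: q algebra_simps)
        finally have "real (card (ind U)) \<le> real (card U + 1) ^ q' * B"
          using less.prems(2) cU cx by (intro less.hyps[OF _ subs(2)]) linarith+
        also have "\<dots> \<le> real (card T) ^ q' * B"
          using cU cx B0 by (intro mult_right_mono power_mono) auto
        finally show ?thesis .
      qed
      moreover have "real (card T) ^ q * B + real (card T) ^ q' * B \<le> real (card T + 1) ^ q * B"
      proof -
        have "real (card T) ^ q' * (real (card T) + 1) \<le> (real (card T) + 1) ^ q' * (real (card T) + 1)"
          by (intro mult_right_mono power_mono) auto
        from mult_right_mono[OF this B0] show ?thesis by (simp add: q algebra_simps)
      qed
      ultimately show ?thesis by linarith
    qed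
  qed
  then show ?thesis using assms(6) by (simp add: ind_def)
qed

text \<open>
  The sum of \<open>x ^ card I\<close> over all subsets is \<open>(1 + x) ^ card T\<close>, and each small subset contributes
  at least \<open>x ^ d\<close>.
\<close>

lemma card_small_subsets_le:
  fixes x :: real
  assumes "finite T" "0 < x" "x \<le> 1"
  shows "card {I. I \<subseteq> T \<and> card I \<le> d} \<le> (1 / x) ^ d * exp (x * card T)"
proof -
  have fin: "finite {I. I \<subseteq> T \<and> card I \<le> d}"
    using assms(1) by (auto intro: finite_subset[of _ "Pow T"])
  have "x ^ d * card {I. I \<subseteq> T \<and> card I \<le> d} \<le> (\<Sum>I | I \<subseteq> T \<and> card I \<le> d. x ^ card I)"
    using sum_bounded_below[of "{I. I \<subseteq> T \<and> card I \<le> d}" "x ^ d" "\<lambda>I. x ^ card I"] assms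
    by (simp add: mult.commute power_decreasing)
  also have "\<dots> \<le> (\<Sum>I\<in>Pow T. x ^ card I)"
    using assms by (intro sum_mono2) auto
  also have "\<dots> = (1 + x) ^ card T"
    using assms(1)
  proof (induction T)
    case (insert a T)
    then have "(\<Sum>I\<in>Pow (insert a T). x ^ card I) =
        (\<Sum>I\<in>Pow T. x ^ card I) + (\<Sum>I\<in>insert a ` Pow T. x ^ card I)"
      unfolding Pow_insert by (intro sum.union_disjoint) auto
    also have "(\<Sum>I\<in>insert a ` Pow T. x ^ card I) = (\<Sum>I\<in>Pow T. x * x ^ card I)"
      using insert by (subst sum.reindex)
        (auto simp: inj_on_def card_insert_if finite_subset intro!: sum.cong)
    finally show ?case
      using insert by (simp add: sum_distrib_left[symmetric] algebra_simps)
  qed auto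
  also have "\<dots> \<le> exp x ^ card T"
    using assms by (intro power_mono) auto
  also have "\<dots> = exp (x * card T)"
    by (simp add: exp_of_nat2_mult)
  finally show ?thesis
    using assms by (simp add: power_one_over field_simps)
qed

section \<open>Graphs whose short cycles lie in cliques\<close>

text \<open>
  The shadow of a linear hypergraph of large girth has this property with the uniformity minus one
  for \<open>t\<close>: the neighbours \<open>z\<close> and \<open>z'\<close> of \<open>w\<close> on a cycle of length at most \<open>2 * p + 2\<close> are adjacent,
  and the bound on common neighbours bounds the cliques. Unlike being the shadow of a uniform
  hypergraph, it is inherited by induced subgraphs.
\<close>

definition cycles_in_cliques :: "nat \<Rightarrow> nat \<Rightarrow> 'a set \<Rightarrow> 'a rel \<Rightarrow> bool" where
  "cycles_in_cliques p t A E \<longleftrightarrow> E \<subseteq> A \<times> A \<and> sym E \<and> irrefl E \<and>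
     (\<forall>w z z' m. (w, z) \<in> E \<longrightarrow> (w, z') \<in> E \<longrightarrow> z \<noteq> z' \<longrightarrow> m \<le> 2 * p \<longrightarrow>
        (z, z') \<in> delete_vertex w E ^^ m \<longrightarrow> (z, z') \<in> E) \<and>
     (\<forall>u v. (u, v) \<in> E \<longrightarrow> card (E `` {u} \<inter> E `` {v}) < t)"

text \<open>
  If \<open>0 < p\<close> and the short cycles of \<open>E\<close> lie in cliques, then the maximal cliques share no arcs,
  and \<open>thin E\<close> consists of one spanning star per maximal clique, centred at its least vertex.
\<close>

definition thin :: "'a::linorder rel \<Rightarrow> 'a rel" where
  "thin E = {(u, v) \<in> E. \<forall>c. (u, c) \<in> E \<longrightarrow> (v, c) \<in> E \<longrightarrow> min u v < c}"

lemma thin_subset: "thin E \<subseteq> E"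
  by (auto simp: thin_def)

text \<open>
  In a triangle of \<open>E\<close>, two edges of \<open>thin E\<close> can meet only in the least vertex. On a shortest
  cycle of \<open>thin E\<close>, if its length is at most \<open>2 * p + 2\<close>, any two consecutive edges span a triangle of \<open>E\<close>, so two adjacent vertices
  \<open>w\<close> and \<open>z\<close> of the cycle would each have to be smaller than the other.
\<close>

lemma no_short_cycle_thin:
  fixes E :: "'a::linorder rel"
  assumes "cycles_in_cliques p t A E"
  shows "no_short_cycle p (thin E)"
proof -
  have sym: "sym E" and irr: "irrefl E" and
    cl: "\<And>w z z' m. (w, z) \<in> E \<Longrightarrow> (w, z') \<in> E \<Longrightarrow> z \<noteq> z' \<Longrightarrow> m \<le> 2 * p \<Longrightarrow>
        (z, z') \<in> delete_vertex w E ^^ m \<Longrightarrow> (z, z') \<in> E"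
    using assms unfolding cycles_in_cliques_def by blast+
  have symE: "(y, x) \<in> E" if "(x, y) \<in> E" for x y
    using sym that by (rule symD)
  have symT: "sym (thin E)"
    using symE by (auto simp: thin_def sym_def min.commute)
  have mono: "delete_vertex w (thin E) ^^ m \<subseteq> delete_vertex w E ^^ m" for w m
    by (rule relpow_subset) (auto simp: delete_vertex_def thin_def)
  have centre: "w < z" if t: "(w, z) \<in> thin E" "(w, z') \<in> thin E" "(z, z') \<in> E" for w z z'
  proof -
    have "(w, z') \<in> E" "(w, z) \<in> E" "(z', z) \<in> E" using t symE by (auto simp: thin_def)
    with t have "min w z < z'" "min w z' < z" by (auto simp: thin_def)
    then show ?thesis by (auto simp: min_def split: if_splits)
  qed
  have False if "(w, z) \<in> thin E" "(w, z') \<in> thin E" "z \<noteq> z'" "m \<le> 2 * p"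
    "(z, z') \<in> delete_vertex w (thin E) ^^ m" for w z z' m
    using that
  proof (induction m arbitrary: w z z' rule: less_induct)
    case (less m)
    define R where "R = delete_vertex w (thin E)"
    have shorter: "(z, z') \<notin> R ^^ i" if "i < m" for i
      using less that unfolding R_def by force
    from less.prems obtain m' where m: "m = Suc m'" by (cases m) auto
    obtain u where u: "(z, u) \<in> R" "(u, z') \<in> R ^^ m'"
      using less.prems(5) relpow_Suc_D2 unfolding m R_def by metis
    have E: "(w, z) \<in> E" "(w, z') \<in> E" using less.prems thin_subset by blast+
    then have zz': "(z, z') \<in> E"
      using cl less.prems mono by blast
    then have "w < z" using centre less.prems by blast
    have zu: "(z, u) \<in> thin E" "u \<noteq> w" using u(1) by (auto simp: R_def delete_vertex_def)
    have symR: "sym R" using symT by (simp add: R_def sym_delete_vertex)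
    \<comment> \<open>Rotating the cycle by one step makes \<open>z\<close> the distinguished vertex, with neighbours \<open>u\<close> and \<open>w\<close>.\<close>
    have "(u, z') \<in> delete_vertex z R ^^ m'"
    proof -
      have "(z', u) \<in> delete_vertex z R ^^ m'"
      proof (rule walk_avoids_vertex)
        show "(z', u) \<in> R ^^ m'" using symR u(2) by (rule sym_relpow)
        show "u \<noteq> z" using zu irr thin_subset by (auto simp: irrefl_def)
        show "\<forall>i<m'. (z', z) \<notin> R ^^ i"
          using shorter sym_relpow[OF symR] m by (metis less_SucI)
      qed
      then show ?thesis using symR by (blast intro: sym_relpow sym_delete_vertex)
    qed
    moreover have "delete_vertex z R ^^ m' \<subseteq> delete_vertex z E ^^ m'"
      by (rule relpow_subset) (auto simp: R_def delete_vertex_def thin_def)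
    moreover have "(z', w) \<in> delete_vertex z E"
      using E(2) symE irr less.prems E(1) by (auto simp: delete_vertex_def irrefl_def)
    ultimately have "(u, w) \<in> delete_vertex z E ^^ Suc m'"
      by auto
    moreover have "(z, u) \<in> E" "(z, w) \<in> E" using zu E symE thin_subset by blast+
    ultimately have "(u, w) \<in> E"
      using cl[of z u w m] zu less.prems(4) m by blast
    then have "z < w"
      using centre[of z w u] zu symE symT less.prems(1) by (meson symD)
    with \<open>w < z\<close> show False by simp
  qed
  then show ?thesis
    using symT irr by (auto simp: no_short_cycle_def irrefl_def thin_def)
qed

text \<open>
  The neighbours of \<open>v\<close> in one clique are represented by a single neighbour in \<open>thin E\<close>: the centre
  \<open>c\<close> of the star of that clique, or each of them if \<open>v\<close> itself is the centre.
\<close>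

lemma degree_le_thin:
  fixes E :: "'a::linorder rel"
  assumes E: "cycles_in_cliques p t A E" and "finite A" "0 < p"
  shows "card (E `` {v}) \<le> t * card (thin E `` {v})"
proof -
  have sym: "sym E" and irr: "irrefl E" and sub: "E \<subseteq> A \<times> A" and
    cl: "\<And>w z z' m. (w, z) \<in> E \<Longrightarrow> (w, z') \<in> E \<Longrightarrow> z \<noteq> z' \<Longrightarrow> m \<le> 2 * p \<Longrightarrow>
        (z, z') \<in> delete_vertex w E ^^ m \<Longrightarrow> (z, z') \<in> E" and
    codeg: "\<And>u v. (u, v) \<in> E \<Longrightarrow> card (E `` {u} \<inter> E `` {v}) < t"
    using E unfolding cycles_in_cliques_def by blast+
  have symE: "(y, x) \<in> E" if "(x, y) \<in> E" for x y
    using sym that by (rule symD)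
  have fin: "finite (E `` {x})" for x
    using sub \<open>finite A\<close> by (rule_tac finite_subset[of _ A]) auto
  have finT: "finite (thin E `` {v})"
    by (rule finite_subset[OF _ fin[of v]]) (use thin_subset in blast)
  have "E `` {v} \<subseteq> (\<Union>c \<in> thin E `` {v}. insert c (E `` {v} \<inter> E `` {c}))"
  proof
    fix y assume "y \<in> E `` {v}"
    then have vy: "(v, y) \<in> E" by simp
    show "y \<in> (\<Union>c \<in> thin E `` {v}. insert c (E `` {v} \<inter> E `` {c}))"
    proof (cases "(v, y) \<in> thin E")
      case False
      \<comment> \<open>Some common neighbour precedes both \<open>v\<close> and \<open>y\<close>, so the least one is the centre of their clique.\<close>
      define K where "K = E `` {v} \<inter> E `` {y}"
      have K: "finite K" using fin by (simp add: K_def)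
      from False vy obtain c0 where c0: "c0 \<in> K" "c0 \<le> min v y"
        by (auto simp: thin_def K_def not_less)
      define c where "c = Min K"
      have c: "c \<in> K" "c \<le> min v y"
        using Min_in[OF K] Min_le[OF K c0(1)] order_trans[OF _ c0(2)] c0(1) by (auto simp only: c_def)
      then have vc: "(v, c) \<in> E" "(y, c) \<in> E" "c \<noteq> v" "c \<noteq> y"
        using irr by (auto simp: K_def irrefl_def)
      have "(v, c) \<in> thin E"
      proof (rule ccontr)
        assume "(v, c) \<notin> thin E"
        then obtain d where d: "(v, d) \<in> E" "(c, d) \<in> E" "d \<le> min v c"
          using vc by (auto simp: thin_def not_less)
        have "d < c" using d vc irr by (auto simp: irrefl_def min_def le_less split: if_splits)
        with c have "d \<noteq> y" by auto
        have "(d, y) \<in> E"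
        proof (rule cl[of v d y 2])
          have "v \<noteq> d" "v \<noteq> y" using d vy irr by (auto simp: irrefl_def)
          then have "(d, c) \<in> delete_vertex v E" "(c, y) \<in> delete_vertex v E"
            using d vc symE by (auto simp: delete_vertex_def)
          then show "(d, y) \<in> delete_vertex v E ^^ 2"
            by (auto simp: numeral_2_eq_2)
        qed (use d vy \<open>d \<noteq> y\<close> \<open>0 < p\<close> in auto)
        then have "d \<in> K" using d symE by (auto simp: K_def)
        then have "c \<le> d" using K by (simp add: c_def)
        with \<open>d < c\<close> show False by simp
      qed
      then show ?thesis using vc vy symE by auto
    qed auto
  qed
  then have "card (E `` {v}) \<le> card (\<Union>c \<in> thin E `` {v}. insert c (E `` {v} \<inter> E `` {c}))"
    using fin finT by (intro card_mono) auto
  also have "\<dots> \<le> (\<Sum>c\<in>thin E `` {v}. card (insert c (E `` {v} \<inter> E `` {c})))"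
    by (rule card_UN_le[OF finT])
  also have "\<dots> \<le> (\<Sum>c\<in>thin E `` {v}. t)"
  proof (rule sum_mono)
    fix c assume "c \<in> thin E `` {v}"
    then have "card (E `` {v} \<inter> E `` {c}) < t"
      using codeg thin_subset by blast
    then show "card (insert c (E `` {v} \<inter> E `` {c})) \<le> t"
      using card_insert_le_m1 fin by (simp add: card_insert_if)
  qed
  finally show ?thesis by (simp add: mult.commute)
qed

lemma cycles_in_cliques_delete_vertex:
  assumes "cycles_in_cliques p t A E" "finite A"
  shows "cycles_in_cliques p t (A - {v}) (delete_vertex v E)"
proof -
  have sym: "sym E" and irr: "irrefl E" and EA: "E \<subseteq> A \<times> A" and
    cl: "\<And>w z z' m. (w, z) \<in> E \<Longrightarrow> (w, z') \<in> E \<Longrightarrow> z \<noteq> z' \<Longrightarrow> m \<le> 2 * p \<Longrightarrow>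
        (z, z') \<in> delete_vertex w E ^^ m \<Longrightarrow> (z, z') \<in> E" and
    codeg: "\<And>u v. (u, v) \<in> E \<Longrightarrow> card (E `` {u} \<inter> E `` {v}) < t"
    using assms(1) unfolding cycles_in_cliques_def by blast+
  define E' where "E' = delete_vertex v E"
  have E': "(x, y) \<in> E' \<longleftrightarrow> (x, y) \<in> E \<and> x \<noteq> v \<and> y \<noteq> v" for x y
    by (auto simp: E'_def delete_vertex_def)
  have sub: "delete_vertex w E' ^^ m \<subseteq> delete_vertex w E ^^ m" for w m
    by (rule relpow_subset) (auto simp: delete_vertex_def E'_def)
  show ?thesis
    unfolding cycles_in_cliques_def E'_def[symmetric]
  proof (intro conjI allI impI)
    show "E' \<subseteq> (A - {v}) \<times> (A - {v})" using EA E' by auto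
    show "sym E'" using sym by (simp add: E'_def sym_delete_vertex)
    show "irrefl E'" using irr E' by (auto simp: irrefl_def)
    show "(z, z') \<in> E'"
      if z: "(w, z) \<in> E'" "(w, z') \<in> E'" "z \<noteq> z'" "m \<le> 2 * p" "(z, z') \<in> delete_vertex w E' ^^ m"
      for w z z' m
    proof -
      have "(z, z') \<in> delete_vertex w E ^^ m" using z(5) sub by blast
      then show ?thesis using cl[of w z z' m] z(1-4) by (simp add: E')
    qed
    show "card (E' `` {x} \<inter> E' `` {y}) < t" if "(x, y) \<in> E'" for x y
    proof -
      have "card (E' `` {x} \<inter> E' `` {y}) \<le> card (E `` {x} \<inter> E `` {y})"
        using EA E' by (intro card_mono finite_subset[OF _ \<open>finite A\<close>]) auto
      then show ?thesis using codeg[of x y] that by (simp add: E')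
    qed
  qed
qed

text \<open>
  Only walks in \<open>thin E\<close> are excluded, because the supersaturation concerns these. The parts into
  which the neighbourhood of a new vertex is split satisfy the condition even for walks in \<open>E\<close>.
\<close>

definition far_sets :: "nat \<Rightarrow> nat \<Rightarrow> 'a::linorder set \<Rightarrow> 'a rel \<Rightarrow> 'a set set" where
  "far_sets p d A E = {I. I \<subseteq> A \<and> (\<forall>x\<in>I. \<forall>y\<in>I. \<not> (x \<noteq> y \<and> (x, y) \<in> thin E ^^ (2 * p))) \<and> card I \<le> d}"

text \<open>
  Two nonadjacent neighbours of \<open>v\<close> joined by a walk of length \<open>2 * p\<close> that avoids \<open>v\<close> would
  violate the assumption on \<open>E\<close>. Adjacency is transitive on the neighbourhood of \<open>v\<close>, so the
  neighbours can be sorted by their rank inside their own clique; adjacent ones get different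
  ranks.
\<close>

lemma neighbourhood_union_far_sets:
  fixes E :: "'a::linorder rel" and v :: 'a
  assumes E: "cycles_in_cliques p t A E" and "finite A" "0 < p"
  defines "E' \<equiv> delete_vertex v E"
  shows "\<exists>f. f \<in> {..<t} \<rightarrow>\<^sub>E far_sets p (card (E `` {v})) (A - {v}) E' \<and> E `` {v} = (\<Union>i<t. f i)"
proof -
  have sym: "sym E" and irr: "irrefl E" and sub: "E \<subseteq> A \<times> A" and
    cl: "\<And>w z z' m. (w, z) \<in> E \<Longrightarrow> (w, z') \<in> E \<Longrightarrow> z \<noteq> z' \<Longrightarrow> m \<le> 2 * p \<Longrightarrow>
        (z, z') \<in> delete_vertex w E ^^ m \<Longrightarrow> (z, z') \<in> E" and
    codeg: "\<And>u v. (u, v) \<in> E \<Longrightarrow> card (E `` {u} \<inter> E `` {v}) < t"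
    using E unfolding cycles_in_cliques_def by blast+
  have symE: "(y, x) \<in> E" if "(x, y) \<in> E" for x y
    using sym that by (rule symD)
  have fin: "finite (E `` {x})" for x
    using sub \<open>finite A\<close> by (rule_tac finite_subset[of _ A]) auto
  define below where "below x = {y \<in> E `` {v} \<inter> E `` {x}. y < x}" for x
  \<comment> \<open>The rank of \<open>x\<close> in its clique, used as its colour.\<close>
  define f where "f = (\<lambda>i\<in>{..<t}. {x \<in> E `` {v}. card (below x) = i})"
  have rank: "card (below x) < t" if "x \<in> E `` {v}" for x
  proof -
    have "card (below x) \<le> card (E `` {v} \<inter> E `` {x})"
      using fin by (auto simp: below_def intro!: card_mono)
    also have "\<dots> < t" using codeg that by simp
    finally show ?thesis .
  qed
  have trans: "(a, c) \<in> E" if "(v, a) \<in> E" "(v, b) \<in> E" "(v, c) \<in> E" "(a, b) \<in> E" "(b, c) \<in> E" "a \<noteq> c"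
    for a b c
  proof (rule cl[of v a c 2])
    have "(a, b) \<in> delete_vertex v E" "(b, c) \<in> delete_vertex v E"
      using that irr by (auto simp: delete_vertex_def irrefl_def)
    then show "(a, c) \<in> delete_vertex v E ^^ 2"
      by (auto simp: numeral_2_eq_2)
  qed (use that \<open>0 < p\<close> in auto)
  have distinct: "card (below x) < card (below y)"
    if xy: "(v, x) \<in> E" "(v, y) \<in> E" "(x, y) \<in> E" "x < y" for x y
  proof (rule psubset_card_mono)
    show "finite (below y)" by (rule finite_subset[OF _ fin[of v]]) (auto simp: below_def)
    have "x \<in> below y" "x \<notin> below x" using xy symE by (auto simp: below_def)
    moreover have "below x \<subseteq> below y"
    proof
      fix a assume "a \<in> below x"
      then have a: "(v, a) \<in> E" "(x, a) \<in> E" "a < x" by (auto simp: below_def)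
      then have "(a, y) \<in> E"
        using trans[of a x y] xy symE by auto
      then show "a \<in> below y" using a xy symE by (auto simp: below_def)
    qed
    ultimately show "below x \<subset> below y" by blast
  qed
  have far: "(x, y) \<notin> thin E' ^^ (2 * p)"
    if xy: "(v, x) \<in> E" "(v, y) \<in> E" "x \<noteq> y" "card (below x) = card (below y)" for x y
  proof
    assume "(x, y) \<in> thin E' ^^ (2 * p)"
    then have "(x, y) \<in> delete_vertex v E ^^ (2 * p)"
      using relpow_subset[OF thin_subset] unfolding E'_def by blast
    then have "(x, y) \<in> E" using cl xy by blast
    then show False
      using distinct[of x y] distinct[of y x] xy symE by (metis less_irrefl neqE)
  qed
  have "f \<in> {..<t} \<rightarrow>\<^sub>E far_sets p (card (E `` {v})) (A - {v}) E'"
  proof (rule PiE_I)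
    fix i assume "i \<in> {..<t}"
    then have fi: "f i = {x \<in> E `` {v}. card (below x) = i}" by (simp add: f_def)
    then have "f i \<subseteq> E `` {v}" by auto
    moreover from this have "card (f i) \<le> card (E `` {v})" using fin card_mono by blast
    moreover have "E `` {v} \<subseteq> A - {v}" using sub irr by (auto simp: irrefl_def)
    ultimately show "f i \<in> far_sets p (card (E `` {v})) (A - {v}) E'"
      using far unfolding far_sets_def fi by auto
  qed (simp add: f_def)
  moreover have "E `` {v} = (\<Union>i<t. f i)"
    using rank by (auto simp: f_def)
  ultimately show ?thesis by blast
qed

section \<open>Rebuilding a graph along a minimum degree ordering\<close>

lemma finite_far_sets: "finite A \<Longrightarrow> finite (far_sets p d A E)"
  by (rule finite_subset[of _ "Pow A"]) (auto simp: far_sets_def)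

text \<open>
  A graph on \<open>A\<close> is determined by a vertex \<open>v\<close> of minimum degree \<open>d\<close>, the graph without \<open>v\<close>, and the
  neighbourhood of \<open>v\<close>. By minimality, the degrees after the deletion are still at least \<open>d - 1\<close>,
  which is what makes the bound on the number of far sets of size at most \<open>d\<close> available. The bound
  \<open>n\<close> stays fixed during the induction, so that \<open>B\<close> need not be monotone in the size of \<open>A\<close>.
\<close>

lemma card_cycles_in_cliques_le:
  fixes A :: "'a::linorder set" and B :: real
  assumes "0 < p"
    and far: "\<And>A (E :: 'a rel) d. finite A \<Longrightarrow> card A \<le> n \<Longrightarrow> cycles_in_cliques p t A E \<Longrightarrow>
      (\<And>w. w \<in> A \<Longrightarrow> d \<le> Suc (card (E `` {w}))) \<Longrightarrow> card (far_sets p d A E) \<le> B"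
  shows "finite A \<Longrightarrow> card A \<le> n \<Longrightarrow>
    card {E. cycles_in_cliques p t A E} \<le> (real n * (real n + 1) * B ^ t) ^ card A"
proof (induction "card A" arbitrary: A)
  case 0
  then have "{E. cycles_in_cliques p t A E} \<subseteq> {{}}"
    by (auto simp: cycles_in_cliques_def)
  then have "card {E. cycles_in_cliques p t A E} \<le> card {{} :: 'a rel}"
    by (intro card_mono) auto
  then show ?case using 0 by simp
next
  case (Suc m)
  define cls where "cls A = {E :: 'a rel. cycles_in_cliques p t A E}" for A
  define low where "low v E d \<longleftrightarrow> (\<forall>w\<in>A - {v}. d \<le> Suc (card (E `` {w})))" for v d and E :: "'a rel"
  \<comment> \<open>This contains every neighbourhood of \<open>v\<close> that turns \<open>E\<close> into a graph of the class with \<open>v\<close> of minimum degree.\<close>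
  define nbhds where "nbhds v E = (\<Union>d\<in>{d. d \<le> n \<and> low v E d}.
      (\<lambda>f. \<Union>i<t. f i) ` ({..<t} \<rightarrow>\<^sub>E far_sets p d (A - {v}) E))" for v E
  define ext where "ext v E N = E \<union> {v} \<times> N \<union> N \<times> {v}" for v :: 'a and E N
  have "0 \<le> B"
  proof -
    have "cycles_in_cliques p t {} ({} :: 'a rel)"
      by (auto simp: cycles_in_cliques_def irrefl_def sym_def)
    from far[OF _ _ this, of 0] show ?thesis by (simp add: order_trans[OF of_nat_0_le_iff])
  qed
  have fin: "finite (A - {v})" for v using Suc.prems by simp
  have fin_cls: "finite (cls (A - {v}))" for v
    by (rule finite_subset[of _ "Pow ((A - {v}) \<times> (A - {v}))"])
      (use fin in \<open>auto simp: cls_def cycles_in_cliques_def\<close>)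
  have fin_nbhds: "finite (nbhds v E)" for v E
    unfolding nbhds_def by (intro finite_UN_I finite_imageI finite_PiE finite_far_sets fin) auto
  have "cls A \<subseteq> (\<Union>v\<in>A. \<Union>E\<in>cls (A - {v}). ext v E ` nbhds v E)"
  proof
    fix E assume "E \<in> cls A"
    then have E: "cycles_in_cliques p t A E" by (simp add: cls_def)
    then have EA: "E \<subseteq> A \<times> A" and sym: "sym E" and irr: "irrefl E"
      by (auto simp: cycles_in_cliques_def)
    have "A \<noteq> {}" using Suc by auto
    then obtain v where v: "v \<in> A" "\<And>w. w \<in> A \<Longrightarrow> card (E `` {v}) \<le> card (E `` {w})"
      using ex_is_arg_min_if_finite[of A "\<lambda>v. card (E `` {v})"] Suc.prems
      by (auto simp: is_arg_min_linorder)
    define E' where "E' = delete_vertex v E"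
    have E': "E' \<in> cls (A - {v})"
      using cycles_in_cliques_delete_vertex[OF E] Suc.prems by (simp add: cls_def E'_def)
    have fin_E': "finite (E' `` {w})" for w
      using EA delete_vertex_subset[of v E] unfolding E'_def
      by (intro finite_subset[OF _ Suc.prems(1)]) blast
    have "card (E `` {v}) \<le> card A"
      using EA Suc.prems by (intro card_mono) auto
    moreover have "low v E' (card (E `` {v}))"
      unfolding low_def
    proof
      fix w assume w: "w \<in> A - {v}"
      have "card (E `` {w}) \<le> card (insert v (E' `` {w}))"
        using w fin_E'[of w] by (intro card_mono) (auto simp: E'_def delete_vertex_def)
      also have "\<dots> \<le> Suc (card (E' `` {w}))" 
        using fin_E'[of w] by (simp add: card_insert_if)
      finally show "card (E `` {v}) \<le> Suc (card (E' `` {w}))" using v(2)[of w] w by simp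
    qed
    moreover obtain f where f: "f \<in> {..<t} \<rightarrow>\<^sub>E far_sets p (card (E `` {v})) (A - {v}) E'"
      "E `` {v} = (\<Union>i<t. f i)"
      using neighbourhood_union_far_sets[OF E Suc.prems(1) \<open>0 < p\<close>, of v, folded E'_def] by blast
    ultimately have "E `` {v} \<in> nbhds v E'"
      using Suc.prems unfolding nbhds_def by (intro UN_I[of "card (E `` {v})"] image_eqI[of _ _ f]) auto
    moreover have "E = ext v E' (E `` {v})"
      using sym irr by (auto simp: ext_def E'_def delete_vertex_def irrefl_def dest: symD[OF sym])
    ultimately show "E \<in> (\<Union>v\<in>A. \<Union>E\<in>cls (A - {v}). ext v E ` nbhds v E)"
      using v E' by blast
  qed
  then have "card (cls A) \<le> card (\<Union>v\<in>A. \<Union>E\<in>cls (A - {v}). ext v E ` nbhds v E)"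
    using Suc.prems fin_cls fin_nbhds by (intro card_mono) auto
  also have "\<dots> \<le> (\<Sum>v\<in>A. card (\<Union>E\<in>cls (A - {v}). ext v E ` nbhds v E))"
    using Suc.prems by (intro card_UN_le) auto
  also have "\<dots> \<le> (\<Sum>v\<in>A. \<Sum>E\<in>cls (A - {v}). card (nbhds v E))"
    by (intro sum_mono order_trans[OF card_UN_le] fin_cls card_image_le fin_nbhds)
  finally have "real (card (cls A)) \<le> (\<Sum>v\<in>A. \<Sum>E\<in>cls (A - {v}). real (card (nbhds v E)))"
    by (simp flip: of_nat_sum)
  also have "\<dots> \<le> (\<Sum>v\<in>A. \<Sum>E\<in>cls (A - {v}). (real n + 1) * B ^ t)"
  proof (intro sum_mono)
    fix v E assume v: "v \<in> A" and E: "E \<in> cls (A - {v})"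
    define G where "G = {d. d \<le> n \<and> low v E d}"
    have B: "real (card (far_sets p d (A - {v}) E)) \<le> B" if "d \<in> G" for d
      using that E fin Suc.prems card_Diff1_le[of A v]
      by (intro far) (auto simp: G_def low_def cls_def)
    have "card (nbhds v E) \<le> (\<Sum>d\<in>G. card ((\<lambda>f. \<Union>i<t. f i) ` ({..<t} \<rightarrow>\<^sub>E far_sets p d (A - {v}) E)))"
      unfolding nbhds_def G_def[symmetric] by (rule card_UN_le) (simp add: G_def)
    also have "\<dots> \<le> (\<Sum>d\<in>G. card ({..<t} \<rightarrow>\<^sub>E far_sets p d (A - {v}) E))"
      by (intro sum_mono card_image_le finite_PiE finite_far_sets fin) auto
    also have "\<dots> = (\<Sum>d\<in>G. card (far_sets p d (A - {v}) E) ^ t)"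
      by (simp add: card_PiE)
    finally have "real (card (nbhds v E)) \<le> (\<Sum>d\<in>G. real (card (far_sets p d (A - {v}) E)) ^ t)"
      by (simp flip: of_nat_sum of_nat_power)
    also have "\<dots> \<le> (\<Sum>d\<in>G. B ^ t)"
      using B by (intro sum_mono power_mono) auto
    also have "\<dots> = card G * B ^ t" by simp
    also have "\<dots> \<le> (real n + 1) * B ^ t"
    proof (rule mult_right_mono)
      have "card G \<le> card {..n}" by (intro card_mono) (auto simp: G_def)
      then show "real (card G) \<le> real n + 1" by simp
    qed (use \<open>0 \<le> B\<close> in auto)
    finally show "real (card (nbhds v E)) \<le> (real n + 1) * B ^ t" .
  qed
  also have "\<dots> = (\<Sum>v\<in>A. real (card (cls (A - {v})))) * ((real n + 1) * B ^ t)"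
    by (simp add: sum_distrib_right)
  also have "\<dots> \<le> (\<Sum>v\<in>A. (real n * (real n + 1) * B ^ t) ^ m) * ((real n + 1) * B ^ t)"
  proof (intro mult_right_mono sum_mono)
    fix v assume "v \<in> A"
    then have "card (A - {v}) = m" using Suc by simp
    then show "real (card (cls (A - {v}))) \<le> (real n * (real n + 1) * B ^ t) ^ m"
      using Suc.hyps(1)[of "A - {v}"] Suc.hyps(2) Suc.prems by (simp add: cls_def)
  next
    show "0 \<le> (real n + 1) * B ^ t" using \<open>0 \<le> B\<close> by simp
  qed
  also have "\<dots> = card A * ((real n * (real n + 1) * B ^ t) ^ m * ((real n + 1) * B ^ t))"
    by simp
  also have "\<dots> \<le> n * ((real n * (real n + 1) * B ^ t) ^ m * ((real n + 1) * B ^ t))"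
    using Suc.prems \<open>0 \<le> B\<close> by (intro mult_right_mono) auto
  also have "\<dots> = (real n * (real n + 1) * B ^ t) ^ card A"
    unfolding Suc.hyps(2)[symmetric] by (simp add: algebra_simps)
  finally show ?case by (simp add: cls_def)
qed

section \<open>Estimates for the number of far sets\<close>

lemma ln_power_le_powr:
  fixes a :: real
  assumes "0 < a" "a \<le> 1"
  shows "\<exists>c>0. \<forall>n\<ge>1. ln (real n + 1) ^ j \<le> c * real n powr a"
proof (intro exI conjI allI impI)
  define b where "b = a / (real j + 1)"
  have b: "0 < b" using assms by (simp add: b_def)
  show "0 < 2 / b ^ j" using b by simp
  fix n :: nat assume n: "1 \<le> n"
  have "ln (real n + 1) ^ j \<le> ((real n + 1) powr b / b) ^ j"
    using n b by (intro power_mono ln_powr_bound) auto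
  also have "\<dots> = (real n + 1) powr (b * j) / b ^ j"
    by (simp add: power_divide powr_power mult.commute)
  also have "\<dots> \<le> (2 * real n powr a) / b ^ j"
  proof (rule divide_right_mono)
    have "(real n + 1) powr (b * j) \<le> (real n + 1) powr a"
      using assms by (intro powr_mono) (auto simp: b_def field_simps)
    also have "\<dots> \<le> (2 * real n) powr a"
      using assms n by (intro powr_mono2) auto
    also have "\<dots> = 2 powr a * real n powr a"
      by (simp add: powr_mult)
    also have "\<dots> \<le> 2 powr 1 * real n powr a"
      using assms by (intro mult_right_mono powr_mono) auto
    finally show "(real n + 1) powr (b * j) \<le> 2 * real n powr a" by simp
  qed (use b in auto)
  finally show "ln (real n + 1) ^ j \<le> 2 / b ^ j * real n powr a" by simp
qed

text \<open>
  Supersaturation holds for any \<open>D\<close> below the degrees of the thinned graph, which are at least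
  \<open>(d - 1) / t\<close>. The choice of \<open>D\<close> is the minimum of roughly \<open>d / (2 * t)\<close> and \<open>X\<close>; the cap \<open>X\<close> keeps
  the proportion \<open>\<beta>\<close> below one without an appeal to the extremal number of edges. In the exponent,
  the terms with \<open>y\<close> come from the at most \<open>q\<close> branchings and the term with \<open>X\<close> from the subsets of
  the small remaining set.
\<close>

lemma card_far_sets_le_if_large_degree:
  fixes A :: "'a::linorder set"
  assumes E: "cycles_in_cliques p t A E" and A: "finite A" "card A \<le> n" and pos: "0 < p" "0 < n" "2 \<le> t"
    and deg: "\<And>w. w \<in> A \<Longrightarrow> d \<le> Suc (card (E `` {w}))"
    and X: "X = real n powr (1 / (real p + 1))" and y: "y = ln (real n + 1)"
    and d: "2 * real t * X < d * y" "2 * real t \<le> d"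
  shows "card (far_sets p d A E)
    \<le> exp (p * 2 ^ (p + 1) * 4 ^ (p + 1) * y ^ (p + 3) + y + (4 * t * (real p + 1) + 2 + 2 ^ (p + 1)) * X)"
proof -
  have Xn: "X ^ (p + 1) = n" and X1: "1 \<le> X"
  proof -
    have "X ^ (p + 1) = X powr (real p + 1)"
      using pos X powr_realpow[of X "p + 1"] by (simp add: add.commute)
    then show "X ^ (p + 1) = n" using pos by (simp add: X powr_powr)
    show "1 \<le> X" unfolding X using pos by (intro ge_one_powr_ge_zero) auto
  qed
  have y: "y = ln (real n + 1)" "1 / 2 \<le> y"
  proof -
    have "1 / 2 \<le> ln (2 :: real)" using ln_le_minus_one[of "1 / 2 :: real"] by (simp add: ln_div)
    also have "\<dots> \<le> y" unfolding y using pos by simp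
    finally show "1 / 2 \<le> y" .
  qed (rule y)
  define a where "a = d div (2 * t)"
  define D where "D = min a (nat \<lfloor>X\<rfloor>)"
  have "1 \<le> a" using d(2) pos by (auto simp: a_def div_greater_zero_iff Suc_le_eq simp flip: of_nat_mult)
  have da: "d < 2 * t * (a + 1)" "2 * t * a \<le> d"
    using pos dividend_less_times_div[of "2 * t" d] by (simp_all add: a_def)
  have d_le: "d \<le> 4 * t * a"
  proof -
    have "2 * t * (a + 1) \<le> 2 * t * (2 * a)" using \<open>1 \<le> a\<close> by (intro mult_le_mono2) auto
    with da(1) have "d \<le> 2 * t * (2 * a)" by linarith
    then show ?thesis by simp
  qed
  have floor: "real (nat \<lfloor>X\<rfloor>) \<le> X" "X / 2 \<le> real (nat \<lfloor>X\<rfloor>)"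
  proof -
    have "1 \<le> \<lfloor>X\<rfloor>" using X1 by simp
    then have "real (nat \<lfloor>X\<rfloor>) = of_int \<lfloor>X\<rfloor>" "1 \<le> real_of_int \<lfloor>X\<rfloor>" by simp_all
    then show "real (nat \<lfloor>X\<rfloor>) \<le> X" "X / 2 \<le> real (nat \<lfloor>X\<rfloor>)"
      by linarith+
  qed
  have DX: "real D \<le> X" using floor(1) by (auto simp: D_def)
  have "1 \<le> nat \<lfloor>X\<rfloor>" using X1 by linarith
  then have D1: "1 \<le> D" using \<open>1 \<le> a\<close> by (simp add: D_def)
  have D_ge: "X \<le> 4 * y * D"
  proof (cases "D = a")
    case True
    have "2 * real t * X < (4 * t * a) * y"
    proof -
      have "real d * y \<le> real (4 * t * a) * y"
        using d_le y by (intro mult_right_mono) (auto simp only: of_nat_le_iff)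
      with d(1) show ?thesis by linarith
    qed
    then have "2 * real t * X < 2 * real t * (2 * (y * a))" by simp
    then have "X < 2 * (y * a)" using pos by simp
    moreover have "0 \<le> y * a" using y by simp
    ultimately show ?thesis using True by simp
  next
    case False
    then have "X / 2 \<le> D" using floor by (auto simp: D_def min_def split: if_splits)
    moreover have "2 * real D \<le> 4 * y * D" using y by (intro mult_right_mono) auto
    ultimately show ?thesis by simp
  qed
  have degree: "D < card (thin E `` {w})" if "w \<in> A" for w
  proof -
    have "2 * t * a \<le> d" by (rule da)
    also have "d \<le> Suc (card (E `` {w}))" by (rule deg[OF that])
    also have "card (E `` {w}) \<le> t * card (thin E `` {w})"
      using degree_le_thin[OF E A(1) pos(1)] .
    finally have "2 * t * a \<le> Suc (t * card (thin E `` {w}))" by simp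
    moreover have "1 < t * a" using pos(3) \<open>1 \<le> a\<close> mult_le_mono[of 2 t 1 a] by linarith
    ultimately have "t * a < t * card (thin E `` {w})" by linarith
    then have "a < card (thin E `` {w})" by simp
    then show ?thesis by (simp add: D_def)
  qed
  define \<beta> where "\<beta> = real D ^ (p + 1) / (real p * 2 ^ (p + 1) * real n)"
  define s0 where "s0 = 2 * real n / real D ^ p"
  define q where "q = nat \<lceil>y / \<beta>\<rceil>"
  have D_n: "real D ^ (p + 1) \<le> n"
    unfolding Xn[symmetric] using DX by (intro power_mono) auto
  have \<beta>: "0 < \<beta>" "\<beta> \<le> 1"
  proof -
    show "0 < \<beta>" using D1 pos by (simp add: \<beta>_def)
    have "1 * real n \<le> real p * 2 ^ (p + 1) * real n"
    proof (rule mult_right_mono)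
      have "1 * 1 \<le> real p * 2 ^ (p + 1)"
        using pos by (intro mult_mono one_le_power) auto
      then show "1 \<le> real p * 2 ^ (p + 1)" by simp
    qed simp
    with D_n have "real D ^ (p + 1) \<le> real p * 2 ^ (p + 1) * real n" by linarith
    then show "\<beta> \<le> 1" using pos by (simp add: \<beta>_def)
  qed
  have "1 \<le> s0"
  proof -
    have "real D ^ p \<le> real D ^ (p + 1)" using D1 by (intro power_increasing) auto
    with D_n have "real D ^ p \<le> 2 * real n" by linarith
    then show ?thesis using D1 by (simp add: s0_def)
  qed
  have few: "card A * (1 - \<beta>) ^ q \<le> s0"
  proof -
    have "(1 - \<beta>) ^ q \<le> exp (- \<beta>) ^ q"
      using \<beta> exp_ge_add_one_self[of "- \<beta>"] by (intro power_mono) auto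
    also have "\<dots> = exp (- (\<beta> * q))" by (simp add: exp_of_nat2_mult[symmetric])
    also have "\<dots> \<le> exp (- y)"
    proof -
      have "y / \<beta> \<le> q" unfolding q_def by linarith
      then show ?thesis using \<beta> by (simp add: field_simps)
    qed
    also have "\<dots> = 1 / (real n + 1)" by (simp add: y(1) exp_minus inverse_eq_divide)
    finally have "card A * (1 - \<beta>) ^ q \<le> n * (1 / (real n + 1))"
      using A \<beta> by (intro mult_mono) auto
    also have "\<dots> \<le> 1" by simp
    finally show ?thesis using \<open>1 \<le> s0\<close> by simp
  qed
  define B where "B = exp ((4 * t * (real p + 1) + 2 + 2 ^ (p + 1)) * X)"
  have small: "card {I. I \<subseteq> T \<and> card I \<le> d} \<le> B" if T: "T \<subseteq> A" "card T \<le> s0" for T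
  proof (cases "D = a")
    case True
    \<comment> \<open>This weight balances the two factors: \<open>x * s0 = 2 * D\<close>, and \<open>ln (1 / x) \<le> (p + 1) * X / D\<close>.\<close>
    define x where "x = (D / X) ^ (p + 1)"
    have x: "x = real D ^ (p + 1) / n" by (simp only: x_def power_divide Xn)
    have x01: "0 < x" "x \<le> 1" using D1 D_n pos by (simp_all add: x del: power_Suc)
    have "(1 / x) ^ d = (X / D) ^ ((p + 1) * d)"
      by (simp only: x_def power_mult power_divide power_one) (simp add: power_one_over)
    also have "\<dots> \<le> exp (X / D) ^ ((p + 1) * d)"
    proof (rule power_mono)
      have "X / D \<le> 1 + X / D" by simp
      also have "\<dots> \<le> exp (X / D)" by (rule exp_ge_add_one_self)
      finally show "X / D \<le> exp (X / D)" .
    qed (use X1 in simp)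
    also have "\<dots> = exp ((p + 1) * (d * (X / D)))"
      by (simp add: exp_of_nat_mult[symmetric] algebra_simps add_divide_distrib)
    also have "\<dots> \<le> exp ((p + 1) * (4 * t * X))"
    proof -
      have "d * (X / D) \<le> (4 * t * D) * (X / D)"
        using d_le True X1 by (intro mult_right_mono) (auto simp flip: of_nat_mult)
      also have "\<dots> = 4 * t * X" using D1 by simp
      finally show ?thesis unfolding exp_le_cancel_iff by (intro mult_left_mono) auto
    qed
    finally have "(1 / x) ^ d \<le> exp ((p + 1) * (4 * t * X))" .
    moreover have "exp (x * card T) \<le> exp (2 * X)"
    proof -
      have "x * card T \<le> x * s0" using T x01 by (intro mult_left_mono) auto
      also have "\<dots> = 2 * D" using D1 pos by (simp add: x s0_def)
      finally show ?thesis using DX by simp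
    qed
    ultimately have "(1 / x) ^ d * exp (x * card T) \<le> exp ((p + 1) * (4 * t * X)) * exp (2 * X)"
      by (intro mult_mono) auto
    also have "\<dots> \<le> B"
      unfolding B_def exp_add[symmetric] exp_le_cancel_iff using X1 by (simp add: algebra_simps)
    finally show ?thesis
      using card_small_subsets_le[OF finite_subset[OF T(1) A(1)] x01, of d] by linarith
  next
    case False
    \<comment> \<open>With \<open>D\<close> capped, the remaining set has size \<open>O(X)\<close>, and all its subsets can be counted.\<close>
    then have "X / 2 \<le> D" using floor by (auto simp: D_def min_def split: if_splits)
    then have "(X / 2) ^ p \<le> real D ^ p" using X1 by (intro power_mono) auto
    then have "s0 \<le> 2 * real n / (X / 2) ^ p"
      unfolding s0_def using X1 D1 by (intro divide_left_mono mult_pos_pos zero_less_power) auto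
    also have "\<dots> = 2 ^ (p + 1) * X"
      unfolding Xn[symmetric] using X1 by (simp add: power_divide field_simps)
    finally have "card T \<le> 2 ^ (p + 1) * X" using T by simp
    then have "exp (1 * card T) \<le> B"
      unfolding B_def exp_le_cancel_iff using X1 by (simp add: algebra_simps add_increasing add_increasing2)
    then show ?thesis
      using card_small_subsets_le[OF finite_subset[OF T(1) A(1)], of 1 d] by simp
  qed
  have dense: "\<exists>x\<in>T. \<beta> * card T \<le> card {y \<in> T. (x, y) \<in> {(x, y). x \<noteq> y \<and> (x, y) \<in> thin E ^^ (2 * p)}}"
    if T: "T \<subseteq> A" "s0 < card T" for T
  proof -
    have "2 * real n \<le> card T * real D ^ p"
      using T(2) D1 by (simp add: s0_def field_simps)
    then show ?thesis
      using many_close_pairs[OF no_short_cycle_thin[OF E] A(1) _ A(2) _ degree pos(2) pos(1) T(1)]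
        E thin_subset[of E] D1 unfolding \<beta>_def cycles_in_cliques_def by auto
  qed
  have "card (far_sets p d A E) \<le> real (card A + 1) ^ q * B"
    using card_independent_sets_le[OF A(1) less_imp_le[OF \<beta>(1)] \<beta>(2) dense small few]
    by (simp add: far_sets_def)
  also have "\<dots> \<le> (real n + 1) ^ q * B"
    using A by (intro mult_right_mono power_mono) (auto simp: B_def)
  also have "(real n + 1) ^ q = exp (y * q)"
    using exp_of_nat2_mult[of y q] by (simp add: y(1))
  also have "\<dots> \<le> exp (p * 2 ^ (p + 1) * 4 ^ (p + 1) * y ^ (p + 3) + y)"
  proof -
    have q: "q \<le> y * (1 / \<beta>) + 1" unfolding q_def using y \<beta> by (simp add: of_nat_nat)
    have "1 / \<beta> \<le> p * 2 ^ (p + 1) * (4 * y) ^ (p + 1)"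
    proof -
      have "real n \<le> (4 * y * D) ^ (p + 1)"
        unfolding Xn[symmetric] using D_ge X1 by (intro power_mono) auto
      then have "real n / real D ^ (p + 1) \<le> (4 * y) ^ (p + 1)"
        using D1 by (simp only: power_mult_distrib) (simp add: field_simps)
      then have "p * 2 ^ (p + 1) * (real n / real D ^ (p + 1)) \<le> p * 2 ^ (p + 1) * (4 * y) ^ (p + 1)"
        by (intro mult_left_mono) auto
      then show ?thesis by (simp add: \<beta>_def)
    qed
    then have "y * (1 / \<beta>) \<le> y * (p * 2 ^ (p + 1) * (4 * y) ^ (p + 1))"
      using y by (intro mult_left_mono) auto
    with q have "q \<le> y * (p * 2 ^ (p + 1) * (4 * y) ^ (p + 1)) + 1" by linarith
    then have "y * q \<le> y * (y * (p * 2 ^ (p + 1) * (4 * y) ^ (p + 1)) + 1)"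
      using y by (intro mult_left_mono) auto
    also have "\<dots> = p * 2 ^ (p + 1) * 4 ^ (p + 1) * y ^ (p + 3) + y"
      by (simp add: power_mult_distrib numeral_3_eq_3 algebra_simps)
    finally show ?thesis by simp
  qed
  finally show ?thesis
    by (simp add: B_def exp_add mult_right_mono)
qed

text \<open>
  If \<open>d\<close> is at most of order \<open>X / ln (n + 1)\<close>, where \<open>X = n powr (1 / (p + 1))\<close>, the number of all
  sets of size at most \<open>d\<close> is small enough. Otherwise
  the powers of the logarithm in \<open>card_far_sets_le_if_large_degree\<close> are dominated by \<open>X\<close>.
\<close>

lemma card_far_sets_le:
  assumes pos: "0 < p" "2 \<le> t"
  shows "\<exists>K>0. \<forall>n\<ge>1. \<forall>A (E :: 'a::linorder rel) d. finite A \<longrightarrow> card A \<le> n \<longrightarrow>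
    cycles_in_cliques p t A E \<longrightarrow> (\<forall>w\<in>A. d \<le> Suc (card (E `` {w}))) \<longrightarrow>
    card (far_sets p d A E) \<le> exp (K * real n powr (1 / (real p + 1)))"
proof -
  have exponent: "0 < 1 / (real p + 1)" "1 / (real p + 1) \<le> 1" by auto
  obtain c1 where c1: "0 < c1" "\<And>n. 1 \<le> n \<Longrightarrow> ln (real n + 1) \<le> c1 * real n powr (1 / (real p + 1))"
    using ln_power_le_powr[OF exponent, of 1] by auto
  obtain c2 where c2: "0 < c2"
    "\<And>n. 1 \<le> n \<Longrightarrow> ln (real n + 1) ^ (p + 3) \<le> c2 * real n powr (1 / (real p + 1))"
    using ln_power_le_powr[OF exponent, of "p + 3"] by auto
  define Ka where "Ka = 2 * real t * (1 + c1) + 1"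
  define P where "P = real p * 2 ^ (p + 1) * 4 ^ (p + 1)"
  define Q where "Q = 4 * real t * (real p + 1) + 2 + 2 ^ (p + 1)"
  define Kb where "Kb = P * c2 + c1 + Q"
  have K: "0 < Ka" "0 < Kb" "0 \<le> P" "0 < Q"
    using c1 c2 by (auto simp: Ka_def Kb_def P_def Q_def intro!: add_pos_pos add_nonneg_pos)
  have "card (far_sets p d A E) \<le> exp ((Ka + Kb) * real n powr (1 / (real p + 1)))"
    if n: "1 \<le> n" and A: "finite A" "card A \<le> n" and E: "cycles_in_cliques p t A E"
      and deg: "\<forall>w\<in>A. d \<le> Suc (card (E `` {w}))" for n d A and E :: "'a rel"
  proof -
    define X where "X = real n powr (1 / (real p + 1))"
    define y where "y = ln (real n + 1)"
    have X1: "1 \<le> X" unfolding X_def using n by (intro ge_one_powr_ge_zero) auto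
    have y: "0 \<le> y" "y \<le> c1 * X" "y ^ (p + 3) \<le> c2 * X"
      using c1(2)[OF n] c2(2)[OF n] by (auto simp: y_def X_def)
    show ?thesis
    proof (cases "2 * real t * X < d * y \<and> 2 * real t \<le> d")
      case True
      have "card (far_sets p d A E) \<le> exp (P * y ^ (p + 3) + y + Q * X)"
        unfolding P_def Q_def
        using card_far_sets_le_if_large_degree[OF E A pos(1) _ pos(2) _ X_def y_def] True deg n by auto
      also have "\<dots> \<le> exp ((Ka + Kb) * X)"
      proof -
        have "P * y ^ (p + 3) \<le> P * (c2 * X)" using y K by (intro mult_left_mono) auto
        with y have "P * y ^ (p + 3) + y + Q * X \<le> Kb * X" by (simp add: Kb_def algebra_simps)
        also have "\<dots> \<le> (Ka + Kb) * X" using K X1 by (intro mult_right_mono) auto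
        finally show ?thesis by simp
      qed
      finally show ?thesis by (simp add: X_def)
    next
      case False
      have dy: "d * y \<le> 2 * real t * (1 + c1) * X"
      proof (cases "2 * real t * X < d * y")
        case True
        with False have "d * y \<le> 2 * real t * (c1 * X)" using y by (intro mult_mono) auto
        also have "\<dots> \<le> 2 * real t * (1 + c1) * X" using X1 by (simp add: algebra_simps)
        finally show ?thesis .
      next
        case False
        moreover have "0 \<le> 2 * real t * c1 * X" using c1 X1 by simp
        ultimately show ?thesis by (simp add: algebra_simps)
      qed
      have "card (far_sets p d A E) \<le> card {I. I \<subseteq> A \<and> card I \<le> d}"
        using A by (intro card_mono) (auto simp: far_sets_def)
      then have "card (far_sets p d A E) \<le> (real n + 1) ^ d * exp (card A / (real n + 1))"
        using card_small_subsets_le[OF A(1), of "1 / (real n + 1)" d] by simp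
      also have "(real n + 1) ^ d = exp (d * y)"
        by (simp add: y_def exp_of_nat_mult)
      also have "\<dots> * exp (card A / (real n + 1)) \<le> exp (2 * real t * (1 + c1) * X) * exp X"
      proof -
        have "card A / (real n + 1) \<le> 1" using A(2) by simp
        with X1 have "card A / (real n + 1) \<le> X" by linarith
        with dy show ?thesis by (intro mult_mono) auto
      qed
      also have "\<dots> = exp (Ka * X)"
        by (simp add: Ka_def exp_add[symmetric] algebra_simps)
      also have "\<dots> \<le> exp ((Ka + Kb) * X)"
        using K X1 by simp
      finally show ?thesis by (simp add: X_def)
    qed
  qed
  then show ?thesis using K by (intro exI[of _ "Ka + Kb"]) auto
qed

lemma card_cycles_in_cliques_le_exp:
  assumes pos: "0 < p" "2 \<le> t"
  shows "\<exists>K>0. \<forall>A :: 'a::linorder set. finite A \<longrightarrow> A \<noteq> {} \<longrightarrow>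
    card {E. cycles_in_cliques p t A E} \<le> exp (K * real (card A) powr (1 + 1 / (real p + 1)))"
proof -
  have exponent: "0 < 1 / (real p + 1)" "1 / (real p + 1) \<le> 1" by auto
  obtain c where c: "0 < c" "\<And>n. 1 \<le> n \<Longrightarrow> ln (real n + 1) \<le> c * real n powr (1 / (real p + 1))"
    using ln_power_le_powr[OF exponent, of 1] by auto
  obtain K where K: "0 < K" and far: "\<And>n A (E :: 'a rel) d. 1 \<le> n \<Longrightarrow> finite A \<Longrightarrow> card A \<le> n \<Longrightarrow>
    cycles_in_cliques p t A E \<Longrightarrow> (\<And>w. w \<in> A \<Longrightarrow> d \<le> Suc (card (E `` {w}))) \<Longrightarrow>
    card (far_sets p d A E) \<le> exp (K * real n powr (1 / (real p + 1)))"
    using card_far_sets_le[OF pos, where 'a = 'a] by metis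
  have "card {E. cycles_in_cliques p t A E}
      \<le> exp ((2 * c + t * K) * real (card A) powr (1 + 1 / (real p + 1)))"
    if A: "finite A" "A \<noteq> {}" for A :: "'a set"
  proof -
    define n where "n = card A"
    define X where "X = real n powr (1 / (real p + 1))"
    have n: "1 \<le> n" using A by (simp add: n_def Suc_le_eq card_gt_0_iff)
    have "real n * (real n + 1) \<le> (real n + 1) * (real n + 1)" by (intro mult_right_mono) auto
    also have "\<dots> = exp (2 * ln (real n + 1))"
      by (simp add: exp_double power2_eq_square)
    also have "\<dots> \<le> exp (2 * c * X)" using c(2)[OF n] by (simp add: X_def)
    finally have nn: "real n * (real n + 1) \<le> exp (2 * c * X)" .
    have "card {E. cycles_in_cliques p t A E} \<le> (real n * (real n + 1) * exp (K * X) ^ t) ^ card A"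
    proof (rule card_cycles_in_cliques_le[OF pos(1) _ A(1)])
      show "card (far_sets p d A' E) \<le> exp (K * X)"
        if "finite A'" "card A' \<le> n" "cycles_in_cliques p t A' E"
          "\<And>w. w \<in> A' \<Longrightarrow> d \<le> Suc (card (E `` {w}))" for A' d and E :: "'a rel"
        unfolding X_def using far[OF n] that by blast
    qed (simp add: n_def)
    also have "\<dots> \<le> (exp (2 * c * X) * exp (K * X) ^ t) ^ n"
      unfolding n_def[symmetric] using nn by (intro power_mono mult_right_mono) auto
    also have "\<dots> = exp (real n * (2 * c * X + t * (K * X)))"
      by (simp add: exp_of_nat_mult exp_add)
    also have "real n * (2 * c * X + t * (K * X)) = (2 * c + t * K) * (real n * X)"
      by (simp add: algebra_simps)
    also have "real n * X = real n powr (1 + 1 / (real p + 1))"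
      using n by (simp add: X_def powr_add)
    finally show ?thesis by (simp add: n_def)
  qed
  then show ?thesis using c K by (intro exI[of _ "2 * c + t * K"]) (auto intro: add_pos_nonneg)
qed

section \<open>Shadows of linear hypergraphs of large girth\<close>

definition shadow :: "'a hypergraph \<Rightarrow> 'a rel" where
  "shadow H = {(u, v). u \<noteq> v \<and> (\<exists>e\<in>edges H. u \<in> e \<and> v \<in> e)}"

text \<open>
  A shortest closed chain of edges is a linear cycle. Here \<open>w\<close> is the vertex shared by the first and the
  last edge, and the other consecutive edges meet outside \<open>w\<close>. If two nonconsecutive edges met
  outside \<open>w\<close>, the part of the chain between them could be skipped; if an inner edge contained \<open>w\<close>,
  the chain could be closed there.
\<close>

lemma no_short_edge_cycle:
  fixes H :: "'a hypergraph" and h :: "nat \<Rightarrow> 'a set"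
  assumes "r_graph r H" "linear_hypergraph H" "enat l < girth r H" "2 \<le> r"
    and "\<And>i. i \<le> Suc m \<Longrightarrow> h i \<in> edges H" "w \<in> h 0" "w \<in> h (Suc m)" "h 0 \<noteq> h (Suc m)"
    and "\<And>i. i \<le> m \<Longrightarrow> h i \<inter> h (Suc i) - {w} \<noteq> {}" and "m + 2 \<le> l"
  shows False
  using assms(5-)
proof (induction m arbitrary: w h rule: less_induct)
  case (less m)
  note edge = less.prems(1) and w = less.prems(2,3) and ends = less.prems(4)
    and meet = less.prems(5) and short = less.prems(6)
  have fin: "finite (h i)" and card_h: "card (h i) = r" if "i \<le> Suc m" for i
    using assms(1) edge[OF that] by (auto simp: r_graph_def)
  have lin: "card (h i \<inter> h j) \<le> 1" if "h i \<noteq> h j" "i \<le> Suc m" "j \<le> Suc m" for i j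
    using assms(2) edge that by (auto simp: linear_hypergraph_def)
  have one: "card (h i \<inter> h j) = 1" if "h i \<noteq> h j" "i \<le> Suc m" "j \<le> Suc m" "h i \<inter> h j \<noteq> {}" for i j
    using lin[OF that(1-3)] that fin[of i] by (simp add: le_Suc_eq)
  have apart: "h i \<inter> h j \<subseteq> {w}" if ij: "i + 2 \<le> j" "j \<le> Suc m" for i j
  proof (rule ccontr)
    assume neg: "\<not> ?thesis"
    define c where "c = j - i - 1"
    have c: "1 \<le> c" "c \<le> m" "j = Suc (i + c)" using ij by (auto simp: c_def)
    \<comment> \<open>The chain without the edges strictly between \<open>h i\<close> and \<open>h j\<close>.\<close>
    define h' where "h' s = (if s \<le> i then h s else h (s + c))" for s
    have last: "h' (Suc (m - c)) = h (Suc m)" using ij c by (auto simp: h'_def)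
    show False
    proof (rule less.IH[of "m - c" h' w])
      show "h' s \<in> edges H" if "s \<le> Suc (m - c)" for s
        using that c ij by (auto simp: h'_def intro!: edge)
      show "h' s \<inter> h' (Suc s) - {w} \<noteq> {}" if s: "s \<le> m - c" for s
      proof -
        consider "s < i" | "s = i" | "i < s" by linarith
        then show ?thesis
        proof cases
          case 1
          then show ?thesis using meet[of s] ij by (simp add: h'_def)
        next
          case 2
          then show ?thesis using neg c by (auto simp: h'_def)
        next
          case 3
          then show ?thesis using meet[of "s + c"] s c by (simp add: h'_def)
        qed
      qed
    qed (use c w ends short last in \<open>auto simp: h'_def\<close>)
  qed
  have "1 \<le> m"
  proof (rule ccontr)
    assume "\<not> 1 \<le> m"
    then have m: "m = 0" by simp
    obtain z where "z \<in> h 0 \<inter> h 1" "z \<noteq> w" using meet[of 0] m by auto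
    then have "card {w, z} \<le> card (h 0 \<inter> h 1)"
      using w m fin[of 0] by (intro card_mono) auto
    with lin[of 0 1] ends m \<open>z \<noteq> w\<close> show False by simp
  qed
  have big: "\<not> h i \<subseteq> {w}" if "i \<le> Suc m" for i
    using card_mono[of "{w}" "h i"] card_h[OF that] assms(4) by auto
  have distinct: "h i \<noteq> h j" if ij: "i < j" "j \<le> Suc m" for i j
  proof
    assume eq: "h i = h j"
    show False
    proof (cases "i + 2 \<le> j")
      case True
      then show False using apart[of i j] big[of i] eq ij by auto
    next
      case False
      with ij have j: "j = Suc i" by simp
      show False
      proof (cases i)
        case 0
        then have "h 0 \<inter> h 2 - {w} \<noteq> {}" using meet[of 1] eq j \<open>1 \<le> m\<close> by (simp add: numeral_2_eq_2)
        then show False using apart[of 0 2] \<open>1 \<le> m\<close> by auto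
      next
        case (Suc i')
        then have "h i' \<inter> h j - {w} \<noteq> {}" using meet[of i'] eq ij by auto
        then show False using apart[of i' j] Suc j ij by auto
      qed
    qed
  qed
  have inner: "w \<notin> h i" if i: "1 \<le> i" "i \<le> m" for i
  proof
    assume "w \<in> h i"
    have "h 0 \<noteq> h i" using i by (intro distinct) auto
    show False
    proof (rule less.IH[of "i - 1" h w])
      show "w \<in> h (Suc (i - 1))" "h 0 \<noteq> h (Suc (i - 1))"
        using i \<open>w \<in> h i\<close> \<open>h 0 \<noteq> h i\<close> by simp_all
    qed (use i edge w meet short in auto)
  qed
  define e where "e i = h (i - 1)" for i
  define F where "F = (\<Union> (e ` {1..m + 2}), e ` {1..m + 2})"
  have eH: "e i \<in> edges H" if "i \<in> {1..m + 2}" for i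
    using that by (cases i) (auto simp: e_def intro: edge)
  have "linear_cycle r (m + 2) F"
    unfolding linear_cycle_def
  proof (intro conjI exI[of _ e])
    show "3 \<le> m + 2" using \<open>1 \<le> m\<close> by simp
    show "r_graph r F"
      using assms(1) eH by (auto simp: r_graph_def F_def)
    show "verts F = \<Union> (edges F)" "edges F = e ` {1..m + 2}" by (simp_all add: F_def)
    show "inj_on e {1..m + 2}"
    proof (rule linorder_inj_onI)
      fix x y assume "x < y" "x \<in> {1..m + 2}" "y \<in> {1..m + 2}"
      then show "e x \<noteq> e y" using distinct[of "x - 1" "y - 1"] by (auto simp: e_def)
    qed auto
    show "\<forall>i\<in>{1..m + 2 - 1}. card (e i \<inter> e (i + 1)) = 1"
    proof
      fix i assume "i \<in> {1..m + 2 - 1}"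
      then obtain i' where "i = Suc i'" "i' \<le> m" by (cases i) auto
      then show "card (e i \<inter> e (i + 1)) = 1"
        using one[of i' "Suc i'"] distinct[of i' "Suc i'"] meet[of i'] by (auto simp: e_def)
    qed
    show "card (e (m + 2) \<inter> e 1) = 1"
      using one[of "Suc m" 0] ends w by (auto simp: e_def)
    show "\<forall>i j. 1 \<le> i \<and> i < j \<and> j \<le> m + 2 \<and> j \<noteq> i + 1 \<and> \<not> (i = 1 \<and> j = m + 2) \<longrightarrow> e i \<inter> e j = {}"
    proof (intro allI impI)
      fix i j assume ij: "1 \<le> i \<and> i < j \<and> j \<le> m + 2 \<and> j \<noteq> i + 1 \<and> \<not> (i = 1 \<and> j = m + 2)"
      then have "h (i - 1) \<inter> h (j - 1) \<subseteq> {w}" by (intro apart) auto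
      moreover have "w \<notin> h (i - 1) \<or> w \<notin> h (j - 1)"
      proof (cases "i = 1")
        case True
        with ij have "1 \<le> j - 1" "j - 1 \<le> m" by linarith+
        then show ?thesis using inner by blast
      next
        case False
        with ij have "1 \<le> i - 1" "i - 1 \<le> m" by linarith+
        then show ?thesis using inner by blast
      qed
      ultimately show "e i \<inter> e j = {}" by (auto simp: e_def)
    qed
    show "m + 2 = 3 \<longrightarrow> distinct [e 1 \<inter> e 2, e 2 \<inter> e 3, e 3 \<inter> e 1]"
    proof
      assume "m + 2 = 3"
      then have m: "m = 1" by simp
      then have "w \<notin> h 1" "h 0 \<inter> h 2 \<subseteq> {w}" "w \<in> h 2 \<inter> h 0"
        using inner[of 1] apart[of 0 2] w by (auto simp: numeral_2_eq_2)
      moreover have "h 0 \<inter> h 1 \<noteq> {}" using meet[of 0] by auto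
      ultimately have "h 0 \<inter> h 1 \<noteq> h 1 \<inter> h 2" "h 0 \<inter> h 1 \<noteq> h 2 \<inter> h 0" "h 1 \<inter> h 2 \<noteq> h 2 \<inter> h 0"
        by blast+
      then show "distinct [e 1 \<inter> e 2, e 2 \<inter> e 3, e 3 \<inter> e 1]" by (simp add: e_def)
    qed
  qed
  moreover have "subgraph F H"
  proof -
    have "e i \<subseteq> verts H" if "i \<in> {1..m + 2}" for i
      using assms(1) eH[OF that] by (simp add: r_graph_def)
    then have "\<Union> (e ` {1..m + 2}) \<subseteq> verts H" by (rule UN_least)
    moreover have "e ` {1..m + 2} \<subseteq> edges H" using eH by (rule image_subsetI)
    ultimately show ?thesis by (simp add: subgraph_def F_def)
  qed
  ultimately have "girth r H \<le> enat (m + 2)"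
    unfolding girth_def using \<open>1 \<le> m\<close>
    by (intro Inf_lower CollectI exI[of _ "m + 2"] conjI exI[of _ F]) auto
  with assms(3) short show False
    by (metis enat_ord_simps(1) less_le_trans not_less)
qed

text \<open>
  A walk in the shadow that avoids \<open>w\<close> lifts to a chain of edges, which \<open>e\<close> and \<open>e'\<close> would close to
  a short cycle of edges through \<open>w\<close>.
\<close>

lemma edges_through_vertex_eq:
  assumes H: "r_graph r H" "linear_hypergraph H" "enat l < girth r H" "2 \<le> r"
    and e: "e \<in> edges H" "w \<in> e" "z \<in> e" "z \<noteq> w"
    and e': "e' \<in> edges H" "w \<in> e'" "z' \<in> e'" "z' \<noteq> w"
    and walk: "(z, z') \<in> delete_vertex w (shadow H) ^^ m" and "m + 2 \<le> l"
  shows "e = e'"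
proof (rule ccontr)
  assume "e \<noteq> e'"
  obtain f where f: "f 0 = z" "f m = z'" "\<And>i. i < m \<Longrightarrow> (f i, f (Suc i)) \<in> delete_vertex w (shadow H)"
    using walk unfolding relpow_fun_conv by blast
  have "\<exists>g. \<forall>i<m. g i \<in> edges H \<and> f i \<in> g i \<and> f (Suc i) \<in> g i"
  proof -
    have "\<forall>i\<in>{..<m}. \<exists>g. g \<in> edges H \<and> f i \<in> g \<and> f (Suc i) \<in> g"
      using f(3) by (auto simp: delete_vertex_def shadow_def)
    from bchoice[OF this] show ?thesis by auto
  qed
  then obtain g where g: "\<And>i. i < m \<Longrightarrow> g i \<in> edges H \<and> f i \<in> g i \<and> f (Suc i) \<in> g i"
    by blast
  have fw: "f i \<noteq> w" if "i \<le> m" for i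
    using f(3)[of i] f(2) e'(4) that by (cases "i = m") (auto simp: delete_vertex_def)
  define h where "h i = (if i = 0 then e else if i \<le> m then g (i - 1) else e')" for i
  have left: "f i \<in> h i" if "i \<le> m" for i
    using g[of "i - 1"] f(1) e(3) that by (cases i) (auto simp: h_def)
  have right: "f i \<in> h (Suc i)" if "i \<le> m" for i
    using g[of i] f(2) e'(3) that by (cases "i = m") (auto simp: h_def)
  show False
  proof (rule no_short_edge_cycle[OF H, of m h w])
    show "h i \<in> edges H" if "i \<le> Suc m" for i
      using that g[of "i - 1"] e e' by (auto simp: h_def)
    show "h i \<inter> h (Suc i) - {w} \<noteq> {}" if "i \<le> m" for i
      using left right fw that by blast
  qed (use e e' \<open>e \<noteq> e'\<close> \<open>m + 2 \<le> l\<close> in \<open>auto simp: h_def\<close>)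
qed

lemma shadow_triangle:
  assumes H: "r_graph r H" "linear_hypergraph H" "enat l < girth r H" "2 \<le> r" "3 \<le> l"
    and e: "e \<in> edges H" "u \<in> e" "v \<in> e" "u \<noteq> v"
    and y: "(u, y) \<in> shadow H" "(v, y) \<in> shadow H"
  shows "y \<in> e"
proof -
  from y obtain e' where e': "e' \<in> edges H" "u \<in> e'" "y \<in> e'" "y \<noteq> u"
    by (auto simp: shadow_def)
  have walk: "(v, y) \<in> delete_vertex u (shadow H) ^^ 1"
    using y e e' by (auto simp: delete_vertex_def)
  have "e = e'"
    using e(4) H(5) by (intro edges_through_vertex_eq[OF H(1-4) e(1-3) _ e' walk]) auto
  with e' show ?thesis by simp
qed

lemma cycles_in_cliques_shadow:
  assumes H: "r_graph r H" "linear_hypergraph H" "enat l < girth r H" "2 \<le> r"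
    and p: "0 < p" "2 * p + 2 \<le> l"
  shows "cycles_in_cliques p (r - 1) (verts H) (shadow H)"
  unfolding cycles_in_cliques_def
proof (intro conjI allI impI)
  show "shadow H \<subseteq> verts H \<times> verts H"
    using H(1) by (auto simp: shadow_def r_graph_def)
  show "sym (shadow H)" "irrefl (shadow H)"
    by (auto simp: shadow_def sym_def irrefl_def)
  show "(z, z') \<in> shadow H"
    if z: "(w, z) \<in> shadow H" "(w, z') \<in> shadow H" "z \<noteq> z'" "m \<le> 2 * p"
      "(z, z') \<in> delete_vertex w (shadow H) ^^ m" for w z z' m
  proof -
    from z obtain e e' where e: "e \<in> edges H" "w \<in> e" "z \<in> e" "z \<noteq> w"
      and e': "e' \<in> edges H" "w \<in> e'" "z' \<in> e'" "z' \<noteq> w"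
      by (auto simp: shadow_def)
    have "e = e'" by (rule edges_through_vertex_eq[OF H e e' z(5)]) (use z(4) p in simp)
    with e e' z(3) show ?thesis by (auto simp: shadow_def)
  qed
  show "card (shadow H `` {u} \<inter> shadow H `` {v}) < r - 1" if uv: "(u, v) \<in> shadow H" for u v
  proof -
    from uv obtain e where e: "e \<in> edges H" "u \<in> e" "v \<in> e" "u \<noteq> v"
      by (auto simp: shadow_def)
    have "finite e" "card e = r" using H(1) e by (auto simp: r_graph_def)
    have "shadow H `` {u} \<inter> shadow H `` {v} \<subseteq> e - {u, v}"
      using shadow_triangle[OF H _ e] p by (auto simp: shadow_def)
    then have "card (shadow H `` {u} \<inter> shadow H `` {v}) \<le> card (e - {u, v})"
      using \<open>finite e\<close> by (intro card_mono) auto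
    also have "\<dots> = r - 2" using e \<open>card e = r\<close> by (simp add: card_Diff_subset)
    finally show ?thesis using H(4) by simp
  qed
qed

text \<open>
  Two vertices of an edge of \<open>G\<close> lie in some edge of \<open>H\<close>, and by \<open>shadow_triangle\<close> that edge
  contains all the other vertices as well.
\<close>

lemma edges_subset_if_shadow_eq:
  assumes H: "r_graph r H" "linear_hypergraph H" "enat l < girth r H" "2 \<le> r" "3 \<le> l"
    and G: "r_graph r G" "shadow G = shadow H"
  shows "edges G \<subseteq> edges H"
proof
  fix e assume e: "e \<in> edges G"
  then have card_e: "finite e" "card e = r" using G by (auto simp: r_graph_def)
  obtain x y where xy: "x \<in> e" "y \<in> e" "x \<noteq> y"
    using H(4) card_e by (metis card_le_Suc0_iff_eq not_less_eq_eq numeral_2_eq_2)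
  then have "(x, y) \<in> shadow H" using e G(2)[symmetric] by (auto simp: shadow_def)
  then obtain f where f: "f \<in> edges H" "x \<in> f" "y \<in> f" by (auto simp: shadow_def)
  have "e \<subseteq> f"
  proof
    fix u assume u: "u \<in> e"
    show "u \<in> f"
    proof (cases "u = x \<or> u = y")
      case False
      then have "(x, u) \<in> shadow H" "(y, u) \<in> shadow H"
        using e u xy G(2)[symmetric] by (auto simp: shadow_def)
      then show ?thesis using shadow_triangle[OF H f xy(3)] by blast
    qed (use f in auto)
  qed
  moreover have "finite f" "card f = r" using H f by (auto simp: r_graph_def)
  ultimately show "e \<in> edges H" using card_e card_subset_eq f by metis
qed

lemma inj_on_shadow_Forb_L:
  assumes "2 \<le> r" "3 \<le> l"
  shows "inj_on shadow (Forb_L n r l)"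
proof (rule inj_onI)
  fix G H assume "G \<in> Forb_L n r l" "H \<in> Forb_L n r l" "shadow G = shadow H"
  then have "verts G = verts H" "edges G = edges H"
    using edges_subset_if_shadow_eq[of r G l H] edges_subset_if_shadow_eq[of r H l G] assms
    by (auto simp: Forb_L_def)
  then show "G = H" by (rule prod_eqI)
qed

lemma card_Forb_L_le:
  assumes "2 \<le> r" "0 < p" "2 * p + 2 \<le> l"
  shows "card (Forb_L n r l) \<le> card {E. cycles_in_cliques p (r - 1) {1..n} E}"
proof (rule card_inj_on_le)
  show "inj_on shadow (Forb_L n r l)"
    using assms by (intro inj_on_shadow_Forb_L) auto
  show "shadow ` Forb_L n r l \<subseteq> {E. cycles_in_cliques p (r - 1) {1..n} E}"
    using cycles_in_cliques_shadow[of r _ l p] assms by (fastforce simp: Forb_L_def)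
  show "finite {E. cycles_in_cliques p (r - 1) {1..n} E}"
    by (rule finite_subset[of _ "Pow ({1..n} \<times> {1..n})"]) (auto simp: cycles_in_cliques_def)
qed

theorem theorem1p2:
  fixes r l :: nat
  assumes "3 \<le> r" and "4 \<le> l"
  shows "\<exists>C::real. C > 0 \<and> (\<forall>n::nat. n \<ge> 1 \<longrightarrow>
           real (card (Forb_L n r l)) \<le> 2 powr (C * real n powr (1 + 1 / real (l div 2))))"
proof -
  define p where "p = l div 2 - 1"
  have p: "0 < p" "2 * p + 2 \<le> l" "real (l div 2) = real p + 1"
    using assms by (auto simp: p_def)
  obtain K where K: "0 < K" and count: "\<And>A :: nat set. finite A \<Longrightarrow> A \<noteq> {} \<Longrightarrow>
    card {E. cycles_in_cliques p (r - 1) A E} \<le> exp (K * real (card A) powr (1 + 1 / (real p + 1)))"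
  proof -
    have "2 \<le> r - 1" using assms by simp
    from card_cycles_in_cliques_le_exp[OF p(1) this, where 'a = nat] show ?thesis
      using that by blast
  qed
  show ?thesis
  proof (intro exI[of _ "K / ln 2"] conjI allI impI)
    show "0 < K / ln 2" using K by simp
    fix n :: nat assume "1 \<le> n"
    have "real (card (Forb_L n r l)) \<le> card {E. cycles_in_cliques p (r - 1) {1..n} E}"
      using card_Forb_L_le[of r p l n] assms p by simp
    also have "\<dots> \<le> exp (K * real n powr (1 + 1 / (real p + 1)))"
      using count[of "{1..n}"] \<open>1 \<le> n\<close> by simp
    also have "\<dots> = 2 powr (K / ln 2 * real n powr (1 + 1 / real (l div 2)))"
      by (simp add: powr_def p(3))
    finally show "real (card (Forb_L n r l)) \<le> 2 powr (K / ln 2 * real n powr (1 + 1 / real (l div 2)))" .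
  qed
qed

end
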